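(* Consider the set of isomorphism classes of five-dimensional nilpotent Malcev algebras over $\mathbb{C}$. The primary degenerations between them are, up to isomorphism, exactly the following: $g_{5,6}\to g_{5,5}$, $g_{5,6}\to g_{5,4}$, $g_{5,6}\to g_{5,3}$, $M_5\to g_{5,3}$, $g_{5,5}\to n_4\oplus\mathbb{C}$, $g_{5,4}\to n_4\oplus\mathbb{C}$, $g_{5,3}\to n_4\oplus\mathbb{C}$, $g_{5,3}\to g_{5,1}$, $n_4\oplus\mathbb{C}\to g_{5,2}$, $g_{5,2}\to n_3\oplus\mathbb{C}^2$, $g_{5,1}\to n_3\oplus\mathbb{C}^2$, $n_3\oplus\mathbb{C}^2\to\mathbb{C}^5$. Thus, for five-dimensional nilpotent Malcev algebras $A,B$, one has $A\to B$ if and only if there is a directed path (possibly of length $0$) from the isomorphism class of $A$ to that of $B$ in the directed graph with these edges.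
   Context: All algebras are over $\mathbb{C}$. With $J(x,y,z)=(xy)z+(yz)x+(zx)y$, an algebra is a Malcev algebra if it satisfies $xy=-yx$ and $J(x,y,xz)=J(x,y,z)x$. Degeneration: fix an $n$-dimensional vector space $V$. $GL_n(\mathbb{C})$ acts on $\mathrm{Hom}(V\otimes V,V)\cong\mathbb{C}^{n^3}$ by $(g*\mu)(x\otimes y)=g(\mu(g^{-1}x\otimes g^{-1}y))$; orbits $O(\mu)$ correspond to isomorphism classes of $n$-dimensional algebras. If $A,B$ are represented by $\mu,\lambda$, then $A\to B$ ("$A$ degenerates to $B$") means $\lambda\in\overline{O(\mu)}$ (Zariski closure). A degeneration $A\to B$ with $A\not\cong B$ is primary if there is no algebra $C$ with $C\not\cong A$, $C\not\cong B$, $A\to C$ and $C\to B$. Known classification: every five-dimensional nilpotent Malcev algebra is isomorphic to exactly one of the following, given in a basis $e_1,\dots,e_5$ (products not listed are zero or follow from anticommutativity): $\mathbb{C}^5$: zero multiplication. $n_3\oplus\mathbb{C}^2$: $e_1e_2=e_3$. $n_4\oplus\mathbb{C}$: $e_1e_2=e_3$, $e_1e_3=e_4$. $g_{5,1}$: $e_1e_2=e_5$, $e_3e_4=e_5$. $g_{5,2}$: $e_1e_2=e_4$, $e_1e_3=e_5$. $g_{5,3}$: $e_1e_2=e_3$, $e_1e_4=e_5$, $e_2e_3=e_5$. $g_{5,4}$: $e_1e_2=e_3$, $e_1e_3=e_4$, $e_2e_3=e_5$. $g_{5,5}$: $e_1e_2=e_3$, $e_1e_3=e_4$, $e_1e_4=e_5$.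 $g_{5,6}$: $e_1e_2=e_3$, $e_1e_3=e_4$, $e_1e_4=e_5$, $e_2e_3=e_5$. $M_5$: $e_1e_2=e_4$, $e_3e_4=e_5$. All of these except $M_5$ are Lie algebras. *)

theory Defs
  imports "HOL-Analysis.Analysis"
begin

text \<open>An \<open>n\<close>-dimensional complex algebra is a bilinear multiplication on the fixed vector space
  \<open>V = complex ^ 'n\<close>; complex-linear notions refer to the scaling \<open>(*s)\<close>.\<close>

type_synonym 'n alg = "complex ^ 'n \<Rightarrow> complex ^ 'n \<Rightarrow> complex ^ 'n"

definition algebras :: "('n::finite) alg set" where
  "algebras = {\<mu>. (\<forall>x. Vector_Spaces.linear (*s) (*s) (\<lambda>y. \<mu> x y)) \<and>
                  (\<forall>y. Vector_Spaces.linear (*s) (*s) (\<lambda>x. \<mu> x y))}"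

definition alg_iso :: "('n::finite) alg \<Rightarrow> 'n alg \<Rightarrow> bool" (infix "\<cong>\<^sub>a" 50) where
  "\<mu> \<cong>\<^sub>a \<nu> \<longleftrightarrow> (\<exists>f. Vector_Spaces.linear (*s) (*s) f \<and> bij f \<and>
                    (\<forall>x y. f (\<mu> x y) = \<nu> (f x) (f y)))"

definition iso_class :: "('n::finite) alg \<Rightarrow> 'n alg set" where
  "iso_class \<mu> = {\<nu> \<in> algebras. \<mu> \<cong>\<^sub>a \<nu>}"

subsection \<open>Nilpotent Malcev algebras\<close>

definition jacobian :: "('n::finite) alg \<Rightarrow> complex ^ 'n \<Rightarrow> complex ^ 'n \<Rightarrow> complex ^ 'n \<Rightarrow> complex ^ 'n" where
  "jacobian \<mu> x y z = \<mu> (\<mu> x y) z + \<mu> (\<mu> y z) x + \<mu> (\<mu> z x) y"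

definition malcev :: "('n::finite) alg \<Rightarrow> bool" where
  "malcev \<mu> \<longleftrightarrow> \<mu> \<in> algebras \<and> (\<forall>x y. \<mu> x y = - \<mu> y x) \<and>
     (\<forall>x y z. jacobian \<mu> x y (\<mu> x z) = \<mu> (jacobian \<mu> x y z) x)"

text \<open>The powers \<open>A\<^sup>1 = A\<close> and \<open>A\<^sup>n = \<Sum>\<^sub>i A\<^sup>i A\<^sup>n\<^sup>-\<^sup>i\<close> (\<open>0 < i < n\<close>) of a nonassociative algebra.\<close>

fun alg_power :: "('n::finite) alg \<Rightarrow> nat \<Rightarrow> (complex ^ 'n) set" where
  "alg_power \<mu> n = (if n \<le> 1 then UNIV
     else vec.span (\<Union>i\<in>{1..<n}. (\<lambda>(x, y). \<mu> x y) ` (alg_power \<mu> i \<times> alg_power \<mu> (n - i))))"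

declare alg_power.simps [simp del]

definition nilpotent :: "('n::finite) alg \<Rightarrow> bool" where
  "nilpotent \<mu> \<longleftrightarrow> (\<exists>n\<ge>1. alg_power \<mu> n = {0})"

definition nilpotent_malcev :: "('n::finite) alg set" where
  "nilpotent_malcev = {\<mu>. malcev \<mu> \<and> nilpotent \<mu>}"

subsection \<open>Degenerations\<close>

definition gl_act :: "complex ^ 'n ^ 'n \<Rightarrow> ('n::finite) alg \<Rightarrow> 'n alg" where
  "gl_act g \<mu> = (\<lambda>x y. g *v \<mu> (matrix_inv g *v x) (matrix_inv g *v y))"

definition orbit :: "('n::finite) alg \<Rightarrow> 'n alg set" where
  "orbit \<mu> = {gl_act g \<mu> | g. invertible g}"

text \<open>The coordinates on \<open>Hom(V \<otimes> V, V)\<close> are the structure constants in the standard basis.\<close>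

inductive poly_fun :: "(('n::finite) alg \<Rightarrow> complex) \<Rightarrow> bool" where
  const: "poly_fun (\<lambda>\<mu>. c)"
| coord: "poly_fun (\<lambda>\<mu>. \<mu> (axis i 1) (axis j 1) $ k)"
| add: "poly_fun p \<Longrightarrow> poly_fun q \<Longrightarrow> poly_fun (\<lambda>\<mu>. p \<mu> + q \<mu>)"
| mult: "poly_fun p \<Longrightarrow> poly_fun q \<Longrightarrow> poly_fun (\<lambda>\<mu>. p \<mu> * q \<mu>)"

definition zariski_closed :: "('n::finite) alg set \<Rightarrow> bool" where
  "zariski_closed Z \<longleftrightarrow> (\<exists>P. (\<forall>p\<in>P. poly_fun p) \<and> Z = {\<mu> \<in> algebras. \<forall>p\<in>P. p \<mu> = 0})"

definition zariski_closure :: "('n::finite) alg set \<Rightarrow> 'n alg set" where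
  "zariski_closure S = \<Inter> {Z. zariski_closed Z \<and> S \<subseteq> Z}"

definition degenerates :: "('n::finite) alg \<Rightarrow> 'n alg \<Rightarrow> bool" (infix "\<leadsto>" 50) where
  "\<mu> \<leadsto> \<nu> \<longleftrightarrow> \<nu> \<in> zariski_closure (orbit \<mu>)"

definition primary_degeneration :: "('n::finite) alg \<Rightarrow> 'n alg \<Rightarrow> bool" where
  "primary_degeneration \<mu> \<nu> \<longleftrightarrow> \<mu> \<leadsto> \<nu> \<and> \<not> \<mu> \<cong>\<^sub>a \<nu> \<and>
     \<not> (\<exists>\<kappa>\<in>algebras. \<not> \<kappa> \<cong>\<^sub>a \<mu> \<and> \<not> \<kappa> \<cong>\<^sub>a \<nu> \<and> \<mu> \<leadsto> \<kappa> \<and> \<kappa> \<leadsto> \<nu>)"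

subsection \<open>The five-dimensional nilpotent Malcev algebras\<close>

text \<open>A triple \<open>(i, j, k)\<close> in the table stands for \<open>e\<^sub>i e\<^sub>j = e\<^sub>k = - e\<^sub>j e\<^sub>i\<close>, where \<open>e\<^sub>i = axis i 1\<close>.
  In the index type \<open>5\<close> the numeral \<open>5\<close> denotes the same element as \<open>0\<close>, so that \<open>1, \<dots>, 5\<close>
  are its five distinct elements.\<close>

definition table_alg :: "(5 \<times> 5 \<times> 5) set \<Rightarrow> 5 alg" where
  "table_alg T = (\<lambda>x y. \<Sum>(i, j, k)\<in>T. axis k (x $ i * y $ j - x $ j * y $ i))"

definition C5 :: "5 alg" where "C5 = table_alg {}"
definition n3_C2 :: "5 alg" where "n3_C2 = table_alg {(1, 2, 3)}"
definition n4_C :: "5 alg" where "n4_C = table_alg {(1, 2, 3), (1, 3, 4)}"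
definition g51 :: "5 alg" where "g51 = table_alg {(1, 2, 5), (3, 4, 5)}"
definition g52 :: "5 alg" where "g52 = table_alg {(1, 2, 4), (1, 3, 5)}"
definition g53 :: "5 alg" where "g53 = table_alg {(1, 2, 3), (1, 4, 5), (2, 3, 5)}"
definition g54 :: "5 alg" where "g54 = table_alg {(1, 2, 3), (1, 3, 4), (2, 3, 5)}"
definition g55 :: "5 alg" where "g55 = table_alg {(1, 2, 3), (1, 3, 4), (1, 4, 5)}"
definition g56 :: "5 alg" where "g56 = table_alg {(1, 2, 3), (1, 3, 4), (1, 4, 5), (2, 3, 5)}"
definition M5 :: "5 alg" where "M5 = table_alg {(1, 2, 4), (3, 4, 5)}"

definition degeneration_graph :: "(5 alg set \<times> 5 alg set) set" where
  "degeneration_graph = (\<lambda>(A, B). (iso_class A, iso_class B)) `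
     {(g56, g55), (g56, g54), (g56, g53), (M5, g53),
      (g55, n4_C), (g54, n4_C), (g53, n4_C), (g53, g51),
      (n4_C, g52), (g52, n3_C2), (g51, n3_C2), (n3_C2, C5)}"

end

theory Submission
  imports Defs
begin

text \<open>Each of the twelve arrows \<open>A \<rightarrow> B\<close> is realised by a line \<open>B + t C\<close> of algebras that are isomorphic
  to \<open>A\<close> for \<open>t \<noteq> 0\<close>. The missing degenerations are excluded by isomorphism-invariant polynomial
  conditions: the Jacobi identity, nilpotency class, the dimension of \<open>A\<^sup>2\<close>, decomposability of all
  alternating forms \<open>f(xy)\<close>, and the rank of multiplication by elements of the form \<open>xy\<close>.
  Every nilpotent Malcev algebra is brought to one of the ten normal forms by a case distinction on the
  dimensions of the lower central series \<open>A \<supseteq> A\<^sup>2 \<supseteq> A A\<^sup>2 \<supseteq> \<dots>\<close>. The Malcev identities and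
  \<open>x(y(z(vw))) = 0\<close> are themselves closed conditions, so an arbitrary algebra between two nilpotent
  Malcev algebras is again one of the ten, and primary degenerations are the covering pairs of the
  resulting partial order.\<close>

text \<open>A polynomial equation valid on an orbit stays valid on its Zariski closure, so an
  invariant closed condition passes to everything below an algebra. A condition that excludes an
  arrow must be polynomial and isomorphism-invariant at once; quantifying over all vectors and all
  linear forms, instead of basis vectors and coordinates, makes its invariance a mere substitution.
  In the classification let L 1, L 2, L 3 be the terms of the lower central series below A. Since x
  x = 0, a nonzero algebra with one generator modulo L 1 would have L 1 = L 2, which bounds dim L 1
  by 3. The nonzero dimensions of L 1, L 2, L 3 are then: none (\<open>C5\<close>); 1
  (\<open>n3_C2\<close>, \<open>g51\<close>); 2 (\<open>g52\<close>); 2, 1 (\<open>n4_C\<close>,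
  \<open>g53\<close>, \<open>M5\<close>); 3, 2 (\<open>g54\<close>); 3, 2, 1 (\<open>g55\<close>,
  \<open>g56\<close>). Pairwise non-isomorphism of the ten is read off from the order itself:
  isomorphic algebras degenerate to each other, and the order is antisymmetric.\<close>

lemma exhaust_5: "x = 1 \<or> x = 2 \<or> x = 3 \<or> x = 4 \<or> x = (5::5)"
proof (induct x)
  case (of_int z)
  then have "z = 0 \<or> z = 1 \<or> z = 2 \<or> z = 3 \<or> z = 4" by fastforce
  then show ?case by auto
qed

lemma forall_5: "(\<forall>i::5. P i) \<longleftrightarrow> P 1 \<and> P 2 \<and> P 3 \<and> P 4 \<and> P 5"
  by (metis exhaust_5)

lemma UNIV_5: "UNIV = {1, 2, 3, 4, 5::5}"
  using exhaust_5 by auto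

lemma sum_5: "sum f (UNIV::5 set) = f 1 + f 2 + f 3 + f 4 + f 5"
  unfolding UNIV_5 by (simp add: ac_simps)

lemma axis_nth_if: "axis k a $ i = (if i = k then a else 0)"
  by (simp add: axis_def)

lemma linear_iff_scale:
  fixes f :: "complex ^ 'n \<Rightarrow> complex ^ 'm"
  shows "Vector_Spaces.linear (*s) (*s) f \<longleftrightarrow>
    (\<forall>x y. f (x + y) = f x + f y) \<and> (\<forall>c x. f (c *s x) = c *s f x)"
  unfolding Vector_Spaces.linear_def module_hom_def module_hom_axioms_def
  by (auto intro: vec.vector_space_axioms vec.module_axioms)

subsection \<open>Bilinear multiplications\<close>

lemma algebras_iff:
  "\<mu> \<in> algebras \<longleftrightarrow> (\<forall>x y z. \<mu> (x + y) z = \<mu> x z + \<mu> y z) \<and> (\<forall>x y z. \<mu> x (y + z) = \<mu> x y + \<mu> x z)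
     \<and> (\<forall>c x y. \<mu> (c *s x) y = c *s \<mu> x y) \<and> (\<forall>c x y. \<mu> x (c *s y) = c *s \<mu> x y)"
  unfolding algebras_def linear_iff_scale by blast

lemma
  assumes "\<mu> \<in> algebras"
  shows alg_add_left: "\<mu> (x + y) z = \<mu> x z + \<mu> y z"
    and alg_add_right: "\<mu> x (y + z) = \<mu> x y + \<mu> x z"
    and alg_scale_left: "\<mu> (c *s x) y = c *s \<mu> x y"
    and alg_scale_right: "\<mu> x (c *s y) = c *s \<mu> x y"
  using assms by (simp_all add: algebras_iff)

lemma
  assumes "\<mu> \<in> algebras"
  shows alg_zero_left: "\<mu> 0 y = 0"
    and alg_zero_right: "\<mu> x 0 = 0"
    and alg_minus_left: "\<mu> (- x) y = - \<mu> x y"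
    and alg_minus_right: "\<mu> x (- y) = - \<mu> x y"
    and alg_diff_left: "\<mu> (x - z) y = \<mu> x y - \<mu> z y"
    and alg_diff_right: "\<mu> x (y - z) = \<mu> x y - \<mu> x z"
proof -
  show zl: "\<mu> 0 y = 0" for y
    using alg_scale_left[OF assms, of 0 0 y] by simp
  show zr: "\<mu> x 0 = 0" for x
    using alg_scale_right[OF assms, of x 0 0] by simp
  show ml: "\<mu> (- x) y = - \<mu> x y" for x
    using alg_scale_left[OF assms, of "-1" x y] by (simp add: vector_sneg_minus1[symmetric])
  show mr: "\<mu> x (- y) = - \<mu> x y" for y
    using alg_scale_right[OF assms, of x "-1" y] by (simp add: vector_sneg_minus1[symmetric])
  show "\<mu> (x - z) y = \<mu> x y - \<mu> z y"
    using alg_add_left[OF assms, of x "- z" y] by (simp add: ml)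
  show "\<mu> x (y - z) = \<mu> x y - \<mu> x z"
    using alg_add_right[OF assms, of x y "- z"] by (simp add: mr)
qed

lemmas alg_bilinear = alg_add_left alg_add_right alg_scale_left alg_scale_right alg_zero_left
  alg_zero_right alg_minus_left alg_minus_right alg_diff_left alg_diff_right

lemma alg_sum_left:
  assumes "\<mu> \<in> algebras" shows "\<mu> (\<Sum>i\<in>I. f i) y = (\<Sum>i\<in>I. \<mu> (f i) y)"
  by (induct I rule: infinite_finite_induct) (simp_all add: alg_bilinear[OF assms])

lemma alg_sum_right:
  assumes "\<mu> \<in> algebras" shows "\<mu> x (\<Sum>i\<in>I. f i) = (\<Sum>i\<in>I. \<mu> x (f i))"
  by (induct I rule: infinite_finite_induct) (simp_all add: alg_bilinear[OF assms])

lemma alg_expand: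
  assumes "\<mu> \<in> algebras"
  shows "\<mu> (\<Sum>i\<in>UNIV. a i *s b i) (\<Sum>j\<in>UNIV. c j *s b j) =
    (\<Sum>i\<in>UNIV. \<Sum>j\<in>UNIV. (a i * c j) *s \<mu> (b i) (b j))"
proof -
  have "\<mu> (\<Sum>i\<in>UNIV. a i *s b i) (\<Sum>j\<in>UNIV. c j *s b j) =
      (\<Sum>i\<in>UNIV. a i *s \<mu> (b i) (\<Sum>j\<in>UNIV. c j *s b j))"
    by (simp add: alg_sum_left[OF assms] alg_scale_left[OF assms])
  also have "\<dots> = (\<Sum>i\<in>UNIV. \<Sum>j\<in>UNIV. (a i * c j) *s \<mu> (b i) (b j))"
    by (simp add: alg_sum_right[OF assms] alg_scale_right[OF assms] vec.scale_sum_right)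
  finally show ?thesis .
qed

lemma alg_expand_axis:
  assumes "\<mu> \<in> algebras"
  shows "\<mu> x y = (\<Sum>i\<in>UNIV. \<Sum>j\<in>UNIV. (x $ i * y $ j) *s \<mu> (axis i 1) (axis j 1))"
  using alg_expand[OF assms, of "\<lambda>i. x $ i" "\<lambda>i. axis i 1" "\<lambda>i. y $ i"]
  by (simp add: basis_expansion)

lemma table_alg_in_algebras: "table_alg T \<in> algebras"
proof -
  have ax: "axis k a + axis k b = axis k (a + b)" "c *s axis k a = axis k (c * a)"
    for k :: 5 and a b c :: complex
    by (simp_all add: vec_eq_iff axis_nth_if)
  show ?thesis
    unfolding algebras_iff table_alg_def vec.scale_sum_right sum.distrib[symmetric]
    by (auto intro!: sum.cong simp: ax algebra_simps)
qed

lemma alg_add_scaled_in_algebras: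
  assumes "\<mu> \<in> algebras" "\<nu> \<in> algebras"
  shows "(\<lambda>x y. \<mu> x y + t *s \<nu> x y) \<in> algebras"
  by (simp add: algebras_iff alg_bilinear[OF assms(1)] alg_bilinear[OF assms(2)]
      vec.scale_right_distrib mult.commute)

subsection \<open>Isomorphisms and orbits\<close>

lemma alg_iso_refl: "\<mu> \<cong>\<^sub>a \<mu>"
  unfolding alg_iso_def by (rule exI[of _ id]) (auto simp: linear_iff_scale)

lemma alg_iso_sym:
  assumes "\<mu> \<cong>\<^sub>a \<nu>" shows "\<nu> \<cong>\<^sub>a \<mu>"
proof -
  obtain f where f: "Vector_Spaces.linear (*s) (*s) f" "bij f" "\<And>x y. f (\<mu> x y) = \<nu> (f x) (f y)"
    using assms unfolding alg_iso_def by blast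
  let ?g = "inv f"
  have fg: "f (?g x) = x" for x using f(2) by (simp add: bij_is_surj surj_f_inv_f)
  have gf: "?g (f x) = x" for x using f(2) by (simp add: bij_is_inj)
  have "Vector_Spaces.linear (*s) (*s) ?g"
    unfolding linear_iff_scale
  proof (intro conjI allI)
    show "?g (x + y) = ?g x + ?g y" for x y
      using f(1) gf[of "?g x + ?g y"] by (simp add: linear_iff_scale fg)
    show "?g (c *s x) = c *s ?g x" for c x
      using f(1) gf[of "c *s ?g x"] by (simp add: linear_iff_scale fg)
  qed
  moreover have "?g (\<nu> x y) = \<mu> (?g x) (?g y)" for x y
    by (metis f(3) fg gf)
  ultimately show ?thesis
    unfolding alg_iso_def using f(2) bij_imp_bij_inv by blast
qed

lemma alg_iso_trans:
  assumes "\<mu> \<cong>\<^sub>a \<nu>" "\<nu> \<cong>\<^sub>a \<kappa>" shows "\<mu> \<cong>\<^sub>a \<kappa>"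
proof -
  obtain f where f: "Vector_Spaces.linear (*s) (*s) f" "bij f" "\<And>x y. f (\<mu> x y) = \<nu> (f x) (f y)"
    using assms unfolding alg_iso_def by blast
  obtain g where g: "Vector_Spaces.linear (*s) (*s) g" "bij g" "\<And>x y. g (\<nu> x y) = \<kappa> (g x) (g y)"
    using assms unfolding alg_iso_def by blast
  have "Vector_Spaces.linear (*s) (*s) (g \<circ> f)" "bij (g \<circ> f)"
    "(g \<circ> f) (\<mu> x y) = \<kappa> ((g \<circ> f) x) ((g \<circ> f) y)" for x y
    using f g by (auto simp: linear_iff_scale bij_comp)
  then show ?thesis unfolding alg_iso_def by blast
qed

lemma iso_class_eq_iff:
  assumes "\<mu> \<in> algebras" "\<nu> \<in> algebras"
  shows "iso_class \<mu> = iso_class \<nu> \<longleftrightarrow> \<mu> \<cong>\<^sub>a \<nu>"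
proof
  assume "iso_class \<mu> = iso_class \<nu>"
  then have "\<nu> \<in> iso_class \<mu>" using assms by (simp add: iso_class_def alg_iso_refl)
  then show "\<mu> \<cong>\<^sub>a \<nu>" by (simp add: iso_class_def)
next
  assume "\<mu> \<cong>\<^sub>a \<nu>"
  then show "iso_class \<mu> = iso_class \<nu>"
    unfolding iso_class_def by (auto intro: alg_iso_trans alg_iso_trans[OF alg_iso_sym])
qed

lemma matrix_inv_mult:
  fixes g :: "complex ^ 'n ^ 'n"
  assumes "invertible g"
  shows "g ** matrix_inv g = mat 1" "matrix_inv g ** g = mat 1"
proof -
  have "g ** matrix_inv g = mat 1 \<and> matrix_inv g ** g = mat 1"
    unfolding matrix_inv_def by (rule someI_ex) (use assms invertible_def in blast)
  then show "g ** matrix_inv g = mat 1" "matrix_inv g ** g = mat 1" by blast+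
qed

text \<open>Trades matrices for linear bijections. After this only transitivity of degeneration
  returns to \<open>gl_act\<close>.\<close>

lemma orbit_eq:
  assumes "\<mu> \<in> algebras"
  shows "orbit \<mu> = iso_class \<mu>"
proof (intro set_eqI iffI)
  fix \<nu> assume "\<nu> \<in> orbit \<mu>"
  then obtain g where g: "invertible g" and \<nu>: "\<nu> = gl_act g \<mu>"
    unfolding orbit_def by blast
  have inv: "g *v (matrix_inv g *v x) = x" "matrix_inv g *v (g *v x) = x" for x
    using g by (simp_all add: matrix_vector_mul_assoc matrix_inv_mult)
  have "\<nu> \<in> algebras"
    using assms by (simp add: \<nu> gl_act_def algebras_iff matrix_vector_right_distrib vec.scale)
  moreover have "\<mu> \<cong>\<^sub>a \<nu>"
    unfolding alg_iso_def
  proof (intro exI conjI allI)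
    show "Vector_Spaces.linear (*s) (*s) ((*v) g)" by (rule matrix_vector_mul_linear_gen)
    show "bij ((*v) g)" using inv by (metis bij_def inj_def surj_def)
    show "g *v \<mu> x y = \<nu> (g *v x) (g *v y)" for x y by (simp add: \<nu> gl_act_def inv)
  qed
  ultimately show "\<nu> \<in> iso_class \<mu>" by (simp add: iso_class_def)
next
  fix \<nu> assume "\<nu> \<in> iso_class \<mu>"
  then obtain f where f: "Vector_Spaces.linear (*s) (*s) f" "bij f" "\<And>x y. f (\<mu> x y) = \<nu> (f x) (f y)"
    unfolding alg_iso_def iso_class_def by blast
  define g where "g = matrix f"
  have g: "g *v x = f x" for x
    unfolding g_def by (rule matrix_works[OF f(1)])
  have inv: "invertible g"
    using f(2) g by (simp add: invertible_left_inverse matrix_left_invertible_injective bij_def inj_def)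
  have "g *v (matrix_inv g *v x) = x" for x
    using inv by (simp add: matrix_vector_mul_assoc matrix_inv_mult)
  then have "\<nu> = gl_act g \<mu>"
    unfolding gl_act_def by (intro ext) (simp add: g f(3))
  then show "\<nu> \<in> orbit \<mu>" unfolding orbit_def using inv by blast
qed

text \<open>A linear map of a finite-dimensional space onto itself is injective, so a spanning
  family indexed by the coordinates is a basis, and equal structure constants give an
  isomorphism.\<close>

lemma alg_iso_from_basis:
  fixes b :: "'n::finite \<Rightarrow> complex ^ 'n"
  assumes "\<mu> \<in> algebras" "\<nu> \<in> algebras"
    and sp: "vec.span (range b) = UNIV"
    and "\<And>i j. \<mu> (b i) (b j) = (\<Sum>k\<in>UNIV. \<nu> (axis i 1) (axis j 1) $ k *s b k)"
  shows "\<nu> \<cong>\<^sub>a \<mu>"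
proof -
  define f where "f x = (\<Sum>i\<in>UNIV. x $ i *s b i)" for x
  have lin: "Vector_Spaces.linear (*s) (*s) f"
    unfolding linear_iff_scale f_def
    by (simp add: vec.scale_left_distrib sum.distrib vec.scale_sum_right)
  interpret f: Vector_Spaces.linear "(*s)" "(*s)" f by (rule lin)
  have fax: "f (axis i 1) = b i" for i
    unfolding f_def by (simp add: axis_nth_if if_distrib[of "\<lambda>c. c *s _"] cong: if_cong)
  have "vec.span (range b) \<subseteq> range f"
    by (rule vec.span_minimal) (auto simp: fax[symmetric] f.subspace_image)
  then have surj: "surj f" using sp by auto
  then have "bij f"
    unfolding bij_def using vec.linear_surjective_imp_injective[OF lin] by simp
  moreover have "f (\<nu> x y) = \<mu> (f x) (f y)" for x y
  proof -
    have "f (\<nu> x y) = (\<Sum>i\<in>UNIV. \<Sum>j\<in>UNIV. (x $ i * y $ j) *s f (\<nu> (axis i 1) (axis j 1)))"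
      by (subst alg_expand_axis[OF assms(2)]) (simp add: f.sum f.scale)
    also have "\<dots> = \<mu> (f x) (f y)"
      unfolding f_def[of x] f_def[of y] alg_expand[OF assms(1)] assms(4) f_def[of "\<nu> _ _"] ..
    finally show ?thesis .
  qed
  ultimately show ?thesis unfolding alg_iso_def using lin by blast
qed

subsection \<open>Polynomial functions and orbit closures\<close>

text \<open>Expanding a nested product in structure constants uses bilinearity, so such an
  expression agrees with a \<open>poly_fun\<close> only on \<open>algebras\<close>. Agreement there
  is all that closures see.\<close>

definition poly_on :: "(('n::finite) alg \<Rightarrow> complex) \<Rightarrow> bool" where
  "poly_on p \<longleftrightarrow> (\<exists>q. poly_fun q \<and> (\<forall>\<mu>\<in>algebras. q \<mu> = p \<mu>))"

definition polyv_on :: "(('n::finite) alg \<Rightarrow> complex ^ 'n) \<Rightarrow> bool" where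
  "polyv_on F \<longleftrightarrow> (\<forall>k. poly_on (\<lambda>\<mu>. F \<mu> $ k))"

named_theorems poly_intros

lemma poly_on_poly_fun: "poly_fun p \<Longrightarrow> poly_on p"
  unfolding poly_on_def by blast

lemma poly_on_const [poly_intros]: "poly_on (\<lambda>\<mu>. c)"
  by (intro poly_on_poly_fun poly_fun.const)

lemma poly_on_add [poly_intros]:
  assumes "poly_on p" "poly_on q" shows "poly_on (\<lambda>\<mu>. p \<mu> + q \<mu>)"
proof -
  obtain p' q' where "poly_fun p'" "poly_fun q'"
    "\<forall>\<mu>\<in>algebras. p' \<mu> = p \<mu>" "\<forall>\<mu>\<in>algebras. q' \<mu> = q \<mu>"
    using assms unfolding poly_on_def by blast
  then show ?thesis
    unfolding poly_on_def by (intro exI[of _ "\<lambda>\<mu>. p' \<mu> + q' \<mu>"]) (simp add: poly_fun.add)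
qed

lemma poly_on_mult [poly_intros]:
  assumes "poly_on p" "poly_on q" shows "poly_on (\<lambda>\<mu>. p \<mu> * q \<mu>)"
proof -
  obtain p' q' where "poly_fun p'" "poly_fun q'"
    "\<forall>\<mu>\<in>algebras. p' \<mu> = p \<mu>" "\<forall>\<mu>\<in>algebras. q' \<mu> = q \<mu>"
    using assms unfolding poly_on_def by blast
  then show ?thesis
    unfolding poly_on_def by (intro exI[of _ "\<lambda>\<mu>. p' \<mu> * q' \<mu>"]) (simp add: poly_fun.mult)
qed

lemma poly_on_minus [poly_intros]: "poly_on p \<Longrightarrow> poly_on (\<lambda>\<mu>. - p \<mu>)"
  using poly_on_mult[OF poly_on_const[of "-1"]] by simp

lemma poly_on_diff [poly_intros]: "poly_on p \<Longrightarrow> poly_on q \<Longrightarrow> poly_on (\<lambda>\<mu>. p \<mu> - q \<mu>)"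
  using poly_on_add[OF _ poly_on_minus] by fastforce

lemma poly_on_sum [poly_intros]: "(\<And>i. i \<in> I \<Longrightarrow> poly_on (p i)) \<Longrightarrow> poly_on (\<lambda>\<mu>. \<Sum>i\<in>I. p i \<mu>)"
  by (induct I rule: infinite_finite_induct) (simp_all add: poly_on_const poly_on_add)

lemma poly_on_cong: "(\<And>\<mu>. \<mu> \<in> algebras \<Longrightarrow> p \<mu> = q \<mu>) \<Longrightarrow> poly_on q \<Longrightarrow> poly_on p"
  unfolding poly_on_def by force

lemma poly_on_nth [poly_intros]: "polyv_on F \<Longrightarrow> poly_on (\<lambda>\<mu>. F \<mu> $ k)"
  by (simp add: polyv_on_def)

lemma polyv_on_const [poly_intros]: "polyv_on (\<lambda>\<mu>. v)"
  by (simp add: polyv_on_def poly_intros)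

lemma polyv_on_add [poly_intros]: "polyv_on F \<Longrightarrow> polyv_on G \<Longrightarrow> polyv_on (\<lambda>\<mu>. F \<mu> + G \<mu>)"
  by (simp add: polyv_on_def poly_intros)

lemma polyv_on_diff [poly_intros]: "polyv_on F \<Longrightarrow> polyv_on G \<Longrightarrow> polyv_on (\<lambda>\<mu>. F \<mu> - G \<mu>)"
  by (simp add: polyv_on_def poly_intros)

lemma polyv_on_matrix [poly_intros]: "polyv_on F \<Longrightarrow> polyv_on (\<lambda>\<mu>. g *v F \<mu>)"
  by (simp add: polyv_on_def matrix_vector_mult_def poly_intros)

text \<open>The arguments may depend on \<mu> as well, which makes iterated products and Jacobians
  polynomial.\<close>

lemma polyv_on_alg [poly_intros]:
  assumes "polyv_on F" "polyv_on G"
  shows "polyv_on (\<lambda>\<mu>. \<mu> (F \<mu>) (G \<mu>))"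
  unfolding polyv_on_def
proof
  fix k
  show "poly_on (\<lambda>\<mu>. \<mu> (F \<mu>) (G \<mu>) $ k)"
  proof (rule poly_on_cong)
    show "\<mu> (F \<mu>) (G \<mu>) $ k =
        (\<Sum>i\<in>UNIV. \<Sum>j\<in>UNIV. (F \<mu> $ i * G \<mu> $ j) * \<mu> (axis i 1) (axis j 1) $ k)"
      if "\<mu> \<in> algebras" for \<mu>
      by (subst alg_expand_axis[OF that]) simp
    show "poly_on (\<lambda>\<mu>. \<Sum>i\<in>UNIV. \<Sum>j\<in>UNIV. (F \<mu> $ i * G \<mu> $ j) * \<mu> (axis i 1) (axis j 1) $ k)"
      by (intro poly_intros assms poly_on_poly_fun poly_fun.coord)
  qed
qed

text \<open>Functionals that are linear over the complex numbers. Minors are formed with arbitrary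
  ones, so that an isomorphism acts on them by composition.\<close>

definition linear_form :: "(complex ^ 'n \<Rightarrow> complex) \<Rightarrow> bool" where
  "linear_form f \<longleftrightarrow> (\<forall>x y. f (x + y) = f x + f y) \<and> (\<forall>c x. f (c *s x) = c * f x)"

lemma linear_form_nth: "linear_form (\<lambda>x. x $ k)"
  by (simp add: linear_form_def)

lemma linear_form_axis:
  assumes "linear_form f" shows "f (axis k a) = a * f (axis k 1)"
proof -
  have "axis k a = a *s axis k 1" by (simp add: vec_eq_iff axis_nth_if)
  then show ?thesis using assms by (simp add: linear_form_def)
qed

lemma linear_form_expand:
  assumes "linear_form f" shows "f x = (\<Sum>k\<in>UNIV. x $ k * f (axis k 1))"
proof -
  have z: "f 0 = 0" using assms unfolding linear_form_def by (metis add_cancel_right_right)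
  have "f (\<Sum>k\<in>I. x $ k *s axis k 1) = (\<Sum>k\<in>I. x $ k * f (axis k 1))" for I
    using assms by (induct I rule: infinite_finite_induct) (auto simp: linear_form_def z)
  from this[of UNIV] show ?thesis by (simp add: basis_expansion)
qed

lemma poly_on_linear_form [poly_intros]:
  assumes "linear_form f" "polyv_on F" shows "poly_on (\<lambda>\<mu>. f (F \<mu>))"
  unfolding linear_form_expand[OF assms(1), of "F _"] by (intro poly_intros assms)

text \<open>The whole set \<open>algebras\<close> is closed, being cut out by no equation, so orbit
  and limit both lie where a \<open>poly_on\<close> function equals its polynomial
  representative.\<close>

lemma degenerates_iff:
  assumes "\<mu> \<in> algebras"
  shows "\<mu> \<leadsto> \<nu> \<longleftrightarrow> \<nu> \<in> algebras \<and> (\<forall>p. poly_on p \<longrightarrow> (\<forall>\<kappa>\<in>orbit \<mu>. p \<kappa> = 0) \<longrightarrow> p \<nu> = 0)"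
proof
  assume deg: "\<mu> \<leadsto> \<nu>"
  have "zariski_closed algebras"
    unfolding zariski_closed_def by (rule exI[of _ "{}"]) simp
  moreover have orb: "orbit \<mu> \<subseteq> algebras"
    by (simp add: orbit_eq[OF assms] iso_class_def)
  ultimately have \<nu>: "\<nu> \<in> algebras"
    using deg unfolding degenerates_def zariski_closure_def by blast
  moreover have "p \<nu> = 0" if p: "poly_on p" and 0: "\<forall>\<kappa>\<in>orbit \<mu>. p \<kappa> = 0" for p
  proof -
    obtain q where q: "poly_fun q" "\<forall>\<mu>\<in>algebras. q \<mu> = p \<mu>"
      using p unfolding poly_on_def by blast
    let ?Z = "{\<kappa> \<in> algebras. \<forall>p\<in>{q}. p \<kappa> = 0}"
    have "zariski_closed ?Z" unfolding zariski_closed_def using q(1) by blast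
    moreover have "orbit \<mu> \<subseteq> ?Z" using 0 q(2) orb by auto
    ultimately have "\<nu> \<in> ?Z"
      using deg unfolding degenerates_def zariski_closure_def by blast
    then show ?thesis using q(2) \<nu> by simp
  qed
  ultimately show "\<nu> \<in> algebras \<and> (\<forall>p. poly_on p \<longrightarrow> (\<forall>\<kappa>\<in>orbit \<mu>. p \<kappa> = 0) \<longrightarrow> p \<nu> = 0)"
    by blast
next
  assume "\<nu> \<in> algebras \<and> (\<forall>p. poly_on p \<longrightarrow> (\<forall>\<kappa>\<in>orbit \<mu>. p \<kappa> = 0) \<longrightarrow> p \<nu> = 0)"
  then have \<nu>: "\<nu> \<in> algebras" and *: "poly_on p \<Longrightarrow> \<forall>\<kappa>\<in>orbit \<mu>. p \<kappa> = 0 \<Longrightarrow> p \<nu> = 0" for p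
    by blast+
  have "\<nu> \<in> Z" if Z: "zariski_closed Z" "orbit \<mu> \<subseteq> Z" for Z
  proof -
    obtain P where P: "\<forall>p\<in>P. poly_fun p" "Z = {\<mu> \<in> algebras. \<forall>p\<in>P. p \<mu> = 0}"
      using Z(1) unfolding zariski_closed_def by blast
    have "p \<nu> = 0" if "p \<in> P" for p
      by (rule *) (use that P Z(2) poly_on_poly_fun in auto)
    then show ?thesis using P(2) \<nu> by simp
  qed
  then show "\<mu> \<leadsto> \<nu>"
    unfolding degenerates_def zariski_closure_def by blast
qed

lemma degeneratesD:
  assumes "\<mu> \<in> algebras" "\<mu> \<leadsto> \<nu>" "poly_on p" "\<And>\<kappa>. \<kappa> \<in> orbit \<mu> \<Longrightarrow> p \<kappa> = 0"
  shows "p \<nu> = 0"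
  using assms(2-4) unfolding degenerates_iff[OF assms(1)] by blast

lemma degenerates_in_algebras: "\<mu> \<in> algebras \<Longrightarrow> \<mu> \<leadsto> \<nu> \<Longrightarrow> \<nu> \<in> algebras"
  by (simp add: degenerates_iff)

lemma alg_iso_imp_degenerates:
  assumes "\<mu> \<in> algebras" "\<nu> \<in> algebras" "\<mu> \<cong>\<^sub>a \<nu>" shows "\<mu> \<leadsto> \<nu>"
  using assms by (simp add: degenerates_iff orbit_eq iso_class_def)

text \<open>For a fixed invertible g the function p composed with the action of g is again
  polynomial and vanishes on the orbit of \<mu>, hence at \<nu>. As g varies, p vanishes on the
  orbit of \<nu>, hence at \<kappa>.\<close>

lemma degenerates_trans:
  assumes \<mu>: "\<mu> \<in> algebras" and "\<mu> \<leadsto> \<nu>" "\<nu> \<leadsto> \<kappa>" shows "\<mu> \<leadsto> \<kappa>"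
proof -
  have \<nu>: "\<nu> \<in> algebras" using assms degenerates_in_algebras by blast
  have "p \<kappa> = 0" if p: "poly_on p" "\<forall>\<sigma>\<in>orbit \<mu>. p \<sigma> = 0" for p
  proof -
    have "p (gl_act g \<nu>) = 0" if g: "invertible g" for g
    proof -
      have gl_alg: "gl_act g \<sigma> \<in> algebras" if "\<sigma> \<in> algebras" for \<sigma>
        using orbit_eq[OF that] g unfolding orbit_def iso_class_def by blast
      have "poly_on (\<lambda>\<sigma>. q (gl_act g \<sigma>))" if "poly_fun q" for q
        using that
      proof induct
        case (coord i j k)
        then show ?case unfolding gl_act_def by (intro poly_intros)
      qed (intro poly_intros; assumption)+
      moreover obtain q where "poly_fun q" "\<forall>\<sigma>\<in>algebras. q \<sigma> = p \<sigma>"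
        using p(1) unfolding poly_on_def by blast
      ultimately have "poly_on (\<lambda>\<sigma>. p (gl_act g \<sigma>))"
        using gl_alg by (metis (no_types, lifting) poly_on_cong)
      moreover have "p (gl_act g \<sigma>) = 0" if "\<sigma> \<in> orbit \<mu>" for \<sigma>
      proof -
        have "\<sigma> \<in> algebras" "\<mu> \<cong>\<^sub>a \<sigma>" using that \<mu> by (simp_all add: orbit_eq iso_class_def)
        moreover have "gl_act g \<sigma> \<in> orbit \<sigma>" unfolding orbit_def using g by blast
        ultimately have "gl_act g \<sigma> \<in> orbit \<mu>"
          using \<mu> by (auto simp: orbit_eq iso_class_def intro: alg_iso_trans)
        then show ?thesis using p(2) by blast
      qed
      ultimately show ?thesis by (rule degeneratesD[OF \<mu> assms(2)])
    qed
    then have "\<forall>\<sigma>\<in>orbit \<nu>. p \<sigma> = 0" unfolding orbit_def by blast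
    then show ?thesis using degeneratesD[OF \<nu> assms(3) p(1)] by blast
  qed
  moreover have "\<kappa> \<in> algebras" using \<nu> assms(3) degenerates_in_algebras by blast
  ultimately show ?thesis using \<mu> by (simp add: degenerates_iff)
qed

lemma degenerates_alg_iso_cong:
  assumes "\<mu> \<in> algebras" "\<nu> \<in> algebras" "\<mu>' \<in> algebras" "\<nu>' \<in> algebras" "\<mu> \<cong>\<^sub>a \<mu>'" "\<nu> \<cong>\<^sub>a \<nu>'"
  shows "\<mu> \<leadsto> \<nu> \<longleftrightarrow> \<mu>' \<leadsto> \<nu>'"
  using assms by (meson alg_iso_imp_degenerates alg_iso_sym degenerates_trans)

text \<open>Along the line each polynomial is a continuous function of t. It is zero for all t other
  than 0, and 0 is not isolated in the complex plane, so it is zero at t = 0: a Euclidean limit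
  suffices for membership in the Zariski closure.\<close>

lemma degenerates_line:
  assumes \<mu>: "\<mu> \<in> algebras" and \<nu>: "\<nu> \<in> algebras" and \<kappa>: "\<kappa> \<in> algebras"
    and iso: "\<And>t. t \<noteq> 0 \<Longrightarrow> \<mu> \<cong>\<^sub>a (\<lambda>x y. \<nu> x y + t *s \<kappa> x y)"
  shows "\<mu> \<leadsto> \<nu>"
proof -
  let ?\<sigma> = "\<lambda>t x y. \<nu> x y + t *s \<kappa> x y"
  have \<sigma>: "?\<sigma> t \<in> algebras" for t
    by (rule alg_add_scaled_in_algebras[OF \<nu> \<kappa>])
  have "p \<nu> = 0" if p: "poly_on p" "\<forall>\<sigma>\<in>orbit \<mu>. p \<sigma> = 0" for p
  proof -
    obtain q where q: "poly_fun q" "\<forall>\<mu>\<in>algebras. q \<mu> = p \<mu>"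
      using p unfolding poly_on_def by blast
    from q(1) have "continuous_on UNIV (\<lambda>t. q (?\<sigma> t))"
      by induct (auto intro!: continuous_intros)
    then have "((\<lambda>t. q (?\<sigma> t)) \<longlongrightarrow> q (?\<sigma> 0)) (at 0)"
      unfolding continuous_on_def by blast
    moreover have "q (?\<sigma> t) = 0" if "t \<noteq> 0" for t
    proof -
      have "?\<sigma> t \<in> orbit \<mu>"
        using \<sigma>[of t] iso[OF that] by (simp add: orbit_eq[OF \<mu>] iso_class_def)
      then show ?thesis using p(2) q(2) \<sigma>[of t] by simp
    qed
    then have "((\<lambda>t. q (?\<sigma> t)) \<longlongrightarrow> 0) (at 0)"
      by (intro tendsto_eventually) (auto simp: eventually_at_filter)
    ultimately have "q (?\<sigma> 0) = 0"
      using tendsto_unique trivial_limit_at by blast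
    then show ?thesis using q(2) \<nu> by simp
  qed
  then show ?thesis using \<mu> \<nu> by (simp add: degenerates_iff)
qed

subsection \<open>The algebras of the table\<close>

text \<open>Written as a sum of axes so that linear forms distribute over it.\<close>

abbreviation vec5 :: "complex \<Rightarrow> complex \<Rightarrow> complex \<Rightarrow> complex \<Rightarrow> complex \<Rightarrow> complex ^ 5" where
  "vec5 a b c d e \<equiv> axis 1 a + axis 2 b + axis 3 c + axis 4 d + axis 5 e"

lemma table_alg_mult:
  "C5 x y = vec5 0 0 0 0 0"
  "n3_C2 x y = vec5 0 0 (x $ 1 * y $ 2 - x $ 2 * y $ 1) 0 0"
  "n4_C x y = vec5 0 0 (x $ 1 * y $ 2 - x $ 2 * y $ 1) (x $ 1 * y $ 3 - x $ 3 * y $ 1) 0"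
  "g51 x y = vec5 0 0 0 0 ((x $ 1 * y $ 2 - x $ 2 * y $ 1) + (x $ 3 * y $ 4 - x $ 4 * y $ 3))"
  "g52 x y = vec5 0 0 0 (x $ 1 * y $ 2 - x $ 2 * y $ 1) (x $ 1 * y $ 3 - x $ 3 * y $ 1)"
  "g53 x y = vec5 0 0 (x $ 1 * y $ 2 - x $ 2 * y $ 1) 0
     ((x $ 1 * y $ 4 - x $ 4 * y $ 1) + (x $ 2 * y $ 3 - x $ 3 * y $ 2))"
  "g54 x y = vec5 0 0 (x $ 1 * y $ 2 - x $ 2 * y $ 1) (x $ 1 * y $ 3 - x $ 3 * y $ 1)
     (x $ 2 * y $ 3 - x $ 3 * y $ 2)"
  "g55 x y = vec5 0 0 (x $ 1 * y $ 2 - x $ 2 * y $ 1) (x $ 1 * y $ 3 - x $ 3 * y $ 1)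
     (x $ 1 * y $ 4 - x $ 4 * y $ 1)"
  "g56 x y = vec5 0 0 (x $ 1 * y $ 2 - x $ 2 * y $ 1) (x $ 1 * y $ 3 - x $ 3 * y $ 1)
     ((x $ 1 * y $ 4 - x $ 4 * y $ 1) + (x $ 2 * y $ 3 - x $ 3 * y $ 2))"
  "M5 x y = vec5 0 0 0 (x $ 1 * y $ 2 - x $ 2 * y $ 1) (x $ 3 * y $ 4 - x $ 4 * y $ 3)"
  by (simp_all add: C5_def n3_C2_def n4_C_def g51_def g52_def g53_def g54_def g55_def g56_def M5_def
      table_alg_def vec_eq_iff axis_nth_if)

lemmas table_defs = C5_def n3_C2_def n4_C_def g51_def g52_def g53_def g54_def g55_def g56_def M5_def

lemma table_in_algebras:
  "C5 \<in> algebras" "n3_C2 \<in> algebras" "n4_C \<in> algebras" "g51 \<in> algebras" "g52 \<in> algebras"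
  "g53 \<in> algebras" "g54 \<in> algebras" "g55 \<in> algebras" "g56 \<in> algebras" "M5 \<in> algebras"
  by (simp_all add: table_defs table_alg_in_algebras)

lemma alg_isoI:
  assumes "Vector_Spaces.linear (*s) (*s) f" "\<And>x. f (g x) = x" "\<And>x. g (f x) = x"
    and "\<And>x y. f (\<mu> x y) = \<nu> (f x) (f y)"
  shows "\<mu> \<cong>\<^sub>a \<nu>"
proof -
  have "bij f" by (rule bij_betw_byWitness[where f' = g]) (use assms in auto)
  then show ?thesis unfolding alg_iso_def using assms by blast
qed

lemmas coord_simps = vec_eq_iff forall_5 axis_nth_if linear_iff_scale table_alg_mult

lemma single_mult: "table_alg {(i, j, k)} x y = axis k (x $ i * y $ j - x $ j * y $ i)"
  by (simp add: table_alg_def)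

text \<open>In every arrow below T is a single triple: one product of the limit algebra is perturbed
  by t.\<close>

lemma degenerates_lineI:
  assumes "\<mu> \<in> algebras" "\<nu> \<in> algebras"
    and "\<And>t. t \<noteq> 0 \<Longrightarrow> (\<lambda>x y. \<nu> x y + t *s table_alg T x y) \<cong>\<^sub>a \<mu>"
  shows "\<mu> \<leadsto> \<nu>"
  by (rule degenerates_line[OF assms(1,2) table_alg_in_algebras]) (rule alg_iso_sym[OF assms(3)])

section \<open>Explicit lines for the twelve arrows\<close>

text \<open>Scaling e2, ..., e5 by t respects the products with e1, while e2 e3 acquires t^2 against
  the t of e5; the surplus factor is the perturbation.\<close>

lemma g56_degenerates_g55: "g56 \<leadsto> g55"
proof (rule degenerates_lineI[where T = "{(2, 3, 5)}"])
  show "(\<lambda>x y. g55 x y + t *s table_alg {(2, 3, 5)} x y) \<cong>\<^sub>a g56" if "t \<noteq> 0" for t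
    by (rule alg_isoI[where f = "\<lambda>x. vec5 (x $ 1) (t * x $ 2) (t * x $ 3) (t * x $ 4) (t * x $ 5)"
          and g = "\<lambda>x. vec5 (x $ 1) (x $ 2 / t) (x $ 3 / t) (x $ 4 / t) (x $ 5 / t)"])
      (use that in \<open>simp_all add: coord_simps single_mult algebra_simps\<close>)
qed (fact table_in_algebras)+

text \<open>The weights 1, 1, 2, 3, 3 make the products of \<open>g54\<close> homogeneous. The added
  e1 e4 has weight 4 and e5 has weight 3, and t makes up the difference.\<close>

lemma g56_degenerates_g54: "g56 \<leadsto> g54"
proof (rule degenerates_lineI[where T = "{(1, 4, 5)}"])
  show "(\<lambda>x y. g54 x y + t *s table_alg {(1, 4, 5)} x y) \<cong>\<^sub>a g56" if "t \<noteq> 0" for t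
    by (rule alg_isoI[where
          f = "\<lambda>x. vec5 (t * x $ 1) (t * x $ 2) (t ^ 2 * x $ 3) (t ^ 3 * x $ 4) (t ^ 3 * x $ 5)"
          and g = "\<lambda>x. vec5 (x $ 1 / t) (x $ 2 / t) (x $ 3 / t ^ 2) (x $ 4 / t ^ 3) (x $ 5 / t ^ 3)"])
      (use that in \<open>simp_all add: coord_simps single_mult algebra_simps power2_eq_square power3_eq_cube\<close>)
qed (fact table_in_algebras)+

text \<open>Again a grading: the weights 1, 1, 2, 2, 3 suit \<open>g53\<close>, and the added e1 e3
  exceeds the weight of e4 by one.\<close>

lemma g56_degenerates_g53: "g56 \<leadsto> g53"
proof (rule degenerates_lineI[where T = "{(1, 3, 4)}"])
  show "(\<lambda>x y. g53 x y + t *s table_alg {(1, 3, 4)} x y) \<cong>\<^sub>a g56" if "t \<noteq> 0" for t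
    by (rule alg_isoI[where
          f = "\<lambda>x. vec5 (t * x $ 1) (t * x $ 2) (t ^ 2 * x $ 3) (t ^ 2 * x $ 4) (t ^ 3 * x $ 5)"
          and g = "\<lambda>x. vec5 (x $ 1 / t) (x $ 2 / t) (x $ 3 / t ^ 2) (x $ 4 / t ^ 2) (x $ 5 / t ^ 3)"])
      (use that in \<open>simp_all add: coord_simps single_mult algebra_simps power2_eq_square power3_eq_cube\<close>)
qed (fact table_in_algebras)+

text \<open>The added product e4 e3 = t e5 lets e1 + e3 / t annihilate e4 and e2 - e4 / t annihilate
  e3. These two vectors and e4 / t are the images of the generators of \<open>M5\<close>; the
  product of the first two is e3 - e5 / t, which explains the correction in the last
  coordinate.\<close>

lemma M5_degenerates_g53: "M5 \<leadsto> g53"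
proof (rule degenerates_lineI[where T = "{(4, 3, 5)}"])
  show "(\<lambda>x y. g53 x y + t *s table_alg {(4, 3, 5)} x y) \<cong>\<^sub>a M5" if "t \<noteq> 0" for t
    by (rule alg_iso_sym, rule alg_isoI[where
          f = "\<lambda>x. vec5 (x $ 1) (x $ 2) (x $ 1 / t + x $ 4) (x $ 3 / t - x $ 2 / t) (x $ 5 - x $ 4 / t)"
          and g = "\<lambda>x. vec5 (x $ 1) (x $ 2) (t * x $ 4 + x $ 2) (x $ 3 - x $ 1 / t)
             (x $ 5 + (x $ 3 - x $ 1 / t) / t)"])
      (use that in \<open>simp_all add: coord_simps single_mult field_simps power2_eq_square\<close>)
qed (fact table_in_algebras)+

lemma g55_degenerates_n4: "g55 \<leadsto> n4_C"
proof (rule degenerates_lineI[where T = "{(1, 4, 5)}"])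
  show "(\<lambda>x y. n4_C x y + t *s table_alg {(1, 4, 5)} x y) \<cong>\<^sub>a g55" if "t \<noteq> 0" for t
    by (rule alg_isoI[where f = "\<lambda>x. vec5 (x $ 1) (x $ 2) (x $ 3) (x $ 4) (x $ 5 / t)"
          and g = "\<lambda>x. vec5 (x $ 1) (x $ 2) (x $ 3) (x $ 4) (t * x $ 5)"])
      (use that in \<open>simp_all add: coord_simps single_mult field_simps\<close>)
qed (fact table_in_algebras)+

lemma g54_degenerates_n4: "g54 \<leadsto> n4_C"
proof (rule degenerates_lineI[where T = "{(2, 3, 5)}"])
  show "(\<lambda>x y. n4_C x y + t *s table_alg {(2, 3, 5)} x y) \<cong>\<^sub>a g54" if "t \<noteq> 0" for t
    by (rule alg_isoI[where f = "\<lambda>x. vec5 (x $ 1) (x $ 2) (x $ 3) (x $ 4) (x $ 5 / t)"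
          and g = "\<lambda>x. vec5 (x $ 1) (x $ 2) (x $ 3) (x $ 4) (t * x $ 5)"])
      (use that in \<open>simp_all add: coord_simps single_mult field_simps\<close>)
qed (fact table_in_algebras)+

text \<open>The chain of nonzero iterated products in \<open>g53\<close> is driven by e2 instead of
  e1, hence the swap of the first two vectors. The free vector e5 of \<open>n4_C\<close> becomes the
  fourth vector of \<open>g53\<close>.\<close>

lemma g53_degenerates_n4: "g53 \<leadsto> n4_C"
proof (rule degenerates_lineI[where T = "{(5, 2, 4)}"])
  show "(\<lambda>x y. n4_C x y + t *s table_alg {(5, 2, 4)} x y) \<cong>\<^sub>a g53" if "t \<noteq> 0" for t
    by (rule alg_isoI[where f = "\<lambda>x. vec5 (x $ 2) (x $ 1) (- x $ 3) (t * x $ 5) (- x $ 4)"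
          and g = "\<lambda>x. vec5 (x $ 2) (x $ 1) (- x $ 3) (- x $ 5) (x $ 4 / t)"])
      (use that in \<open>simp_all add: coord_simps single_mult field_simps\<close>)
qed (fact table_in_algebras)+

text \<open>The e5-coordinate of \<open>g53\<close> is already a form of rank four, as in
  \<open>g51\<close>; the perturbation turns one of the four vectors it pairs into a
  product.\<close>

lemma g53_degenerates_g51: "g53 \<leadsto> g51"
proof (rule degenerates_lineI[where T = "{(1, 3, 4)}"])
  show "(\<lambda>x y. g51 x y + t *s table_alg {(1, 3, 4)} x y) \<cong>\<^sub>a g53" if "t \<noteq> 0" for t
    by (rule alg_isoI[where f = "\<lambda>x. vec5 (x $ 1) (x $ 3) (x $ 4 / t) (x $ 2 / t) (x $ 5 / t)"
          and g = "\<lambda>x. vec5 (x $ 1) (t * x $ 4) (x $ 2) (t * x $ 3) (t * x $ 5)"])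
      (use that in \<open>simp_all add: coord_simps single_mult field_simps\<close>)
qed (fact table_in_algebras)+

text \<open>The perturbed product e1 e2 = e4 + t e3 is no longer annihilated by e1: multiplying once
  more gives t e5. This creates the longer chain of \<open>n4_C\<close>.\<close>

lemma n4_degenerates_g52: "n4_C \<leadsto> g52"
proof (rule degenerates_lineI[where T = "{(1, 2, 3)}"])
  show "(\<lambda>x y. g52 x y + t *s table_alg {(1, 2, 3)} x y) \<cong>\<^sub>a n4_C" if "t \<noteq> 0" for t
    by (rule alg_isoI[where f = "\<lambda>x. vec5 (x $ 1) (x $ 2) (x $ 3 / t) (x $ 5 / t) (x $ 3 - t * x $ 4)"
          and g = "\<lambda>x. vec5 (x $ 1) (x $ 2) (t * x $ 3) (x $ 3 - x $ 5 / t) (t * x $ 4)"])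
      (use that in \<open>simp_all add: coord_simps single_mult field_simps\<close>)
qed (fact table_in_algebras)+

lemma g52_degenerates_n3: "g52 \<leadsto> n3_C2"
proof (rule degenerates_lineI[where T = "{(1, 4, 5)}"])
  show "(\<lambda>x y. n3_C2 x y + t *s table_alg {(1, 4, 5)} x y) \<cong>\<^sub>a g52" if "t \<noteq> 0" for t
    by (rule alg_isoI[where f = "\<lambda>x. vec5 (x $ 1) (x $ 2) (x $ 4) (x $ 3) (x $ 5 / t)"
          and g = "\<lambda>x. vec5 (x $ 1) (x $ 2) (x $ 4) (x $ 3) (t * x $ 5)"])
      (use that in \<open>simp_all add: coord_simps single_mult field_simps\<close>)
qed (fact table_in_algebras)+

lemma g51_degenerates_n3: "g51 \<leadsto> n3_C2"
proof (rule degenerates_lineI[where T = "{(4, 5, 3)}"])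
  show "(\<lambda>x y. n3_C2 x y + t *s table_alg {(4, 5, 3)} x y) \<cong>\<^sub>a g51" if "t \<noteq> 0" for t
    by (rule alg_isoI[where f = "\<lambda>x. vec5 (x $ 1) (x $ 2) (x $ 4) (t * x $ 5) (x $ 3)"
          and g = "\<lambda>x. vec5 (x $ 1) (x $ 2) (x $ 5) (x $ 3) (x $ 4 / t)"])
      (use that in \<open>simp_all add: coord_simps single_mult field_simps\<close>)
qed (fact table_in_algebras)+

lemma n3_degenerates_C5: "n3_C2 \<leadsto> C5"
proof (rule degenerates_lineI[where T = "{(1, 2, 3)}"])
  show "(\<lambda>x y. C5 x y + t *s table_alg {(1, 2, 3)} x y) \<cong>\<^sub>a n3_C2" if "t \<noteq> 0" for t
    by (rule alg_isoI[where f = "\<lambda>x. vec5 (x $ 1) (x $ 2) (x $ 3 / t) (x $ 4) (x $ 5)"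
          and g = "\<lambda>x. vec5 (x $ 1) (x $ 2) (t * x $ 3) (x $ 4) (x $ 5)"])
      (use that in \<open>simp_all add: coord_simps single_mult field_simps\<close>)
qed (fact table_in_algebras)+

subsection \<open>Closed invariants\<close>

lemma alg_isoE:
  assumes "\<mu> \<cong>\<^sub>a \<sigma>"
  obtains f g where "\<And>x y. f (x + y) = f x + f y" "\<And>c x. f (c *s x) = c *s f x"
    "f 0 = 0" "\<And>x. g (f x) = x" "\<And>x. f (g x) = x"
    "\<sigma> = (\<lambda>x y. f (\<mu> (g x) (g y)))"
proof -
  obtain f where f: "Vector_Spaces.linear (*s) (*s) f" "bij f" "\<And>x y. f (\<mu> x y) = \<sigma> (f x) (f y)"
    using assms unfolding alg_iso_def by blast
  interpret f: Vector_Spaces.linear "(*s)" "(*s)" f by (rule f(1))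
  have inv: "inv f (f x) = x" "f (inv f x) = x" for x
    using f(2) by (simp_all add: bij_is_inj bij_is_surj surj_f_inv_f)
  show thesis
    by (rule that[of f "inv f"]) (auto simp: f.add f.scale inv f(3))
qed

lemma linear_form_comp:
  assumes "linear_form \<phi>" "\<And>x y. f (x + y) = f x + f y" "\<And>c x. f (c *s x) = c *s f x"
  shows "linear_form (\<lambda>v. \<phi> (f v))"
  using assms by (simp add: linear_form_def)

text \<open>The equations \<open>q s\<close> range over all vectors and forms in S, so only the
  invariance of I as a whole has to be supplied; no single equation needs to be invariant.\<close>

lemma closed_invariant:
  assumes "\<mu> \<in> algebras" "\<mu> \<leadsto> \<nu>" "I \<mu>"
    and iso: "\<And>\<sigma>. \<mu> \<cong>\<^sub>a \<sigma> \<Longrightarrow> I \<mu> \<Longrightarrow> I \<sigma>"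
    and I: "\<And>\<sigma>. I \<sigma> \<longleftrightarrow> (\<forall>s\<in>S. q s \<sigma> = 0)"
    and poly: "\<And>s. s \<in> S \<Longrightarrow> poly_on (q s)"
  shows "I \<nu>"
proof -
  have "q s \<nu> = 0" if "s \<in> S" for s
  proof (rule degeneratesD[OF assms(1,2) poly[OF that]])
    fix \<sigma> assume "\<sigma> \<in> orbit \<mu>"
    then have "I \<sigma>" using iso assms(1,3) by (simp add: orbit_eq iso_class_def)
    then show "q s \<sigma> = 0" using I that by blast
  qed
  then show ?thesis using I by blast
qed

definition sq_zero :: "('n::finite) alg \<Rightarrow> bool" where
  "sq_zero \<mu> \<longleftrightarrow> (\<forall>x y. \<mu> x y = 0)"

definition class_le2 :: "('n::finite) alg \<Rightarrow> bool" where
  "class_le2 \<mu> \<longleftrightarrow> (\<forall>x y z. \<mu> (\<mu> x y) z = 0)"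

definition class_le3 :: "('n::finite) alg \<Rightarrow> bool" where
  "class_le3 \<mu> \<longleftrightarrow> (\<forall>x y z w. \<mu> (\<mu> (\<mu> x y) z) w = 0)"

text \<open>Nested on the right, as in the construction of \<open>lcs\<close>, because it has to
  yield a vanishing \<open>lcs\<close> for algebras of which nothing else is known.\<close>

definition class_le4 :: "('n::finite) alg \<Rightarrow> bool" where
  "class_le4 \<mu> \<longleftrightarrow> (\<forall>x y z v w. \<mu> x (\<mu> y (\<mu> z (\<mu> v w))) = 0)"

definition jacobi :: "('n::finite) alg \<Rightarrow> bool" where
  "jacobi \<mu> \<longleftrightarrow> (\<forall>x y z. jacobian \<mu> x y z = 0)"

text \<open>Bounds on dimensions and ranks are stated as vanishing minors, which makes them polynomial in
  the structure constants.\<close>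

definition sq_dim_le1 :: "('n::finite) alg \<Rightarrow> bool" where
  "sq_dim_le1 \<mu> \<longleftrightarrow> (\<forall>f h x y z w. linear_form f \<longrightarrow> linear_form h \<longrightarrow>
     f (\<mu> x y) * h (\<mu> z w) - f (\<mu> z w) * h (\<mu> x y) = 0)"

definition sq_dim_le2 :: "('n::finite) alg \<Rightarrow> bool" where
  "sq_dim_le2 \<mu> \<longleftrightarrow> (\<forall>f g h x y z w u v. linear_form f \<longrightarrow> linear_form g \<longrightarrow> linear_form h \<longrightarrow>
     f (\<mu> x y) * (g (\<mu> z w) * h (\<mu> u v) - g (\<mu> u v) * h (\<mu> z w))
     - f (\<mu> z w) * (g (\<mu> x y) * h (\<mu> u v) - g (\<mu> u v) * h (\<mu> x y))
     + f (\<mu> u v) * (g (\<mu> x y) * h (\<mu> z w) - g (\<mu> z w) * h (\<mu> x y)) = 0)"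

text \<open>Every alternating form \<open>f \<circ> \<mu>\<close> has rank at most two, stated as the Pluecker relation
  \<open>(f \<circ> \<mu>) \<and> (f \<circ> \<mu>) = 0\<close>.\<close>

definition forms_decomposable :: "('n::finite) alg \<Rightarrow> bool" where
  "forms_decomposable \<mu> \<longleftrightarrow> (\<forall>f x y z w. linear_form f \<longrightarrow>
     f (\<mu> x y) * f (\<mu> z w) - f (\<mu> x z) * f (\<mu> y w) + f (\<mu> x w) * f (\<mu> y z) = 0)"

text \<open>Separates \<open>g55\<close> from \<open>g54\<close>. In \<open>g55\<close> a product x
  y acts on z only through the first coordinate of z, whereas in \<open>g54\<close> the product e1
  e2 = e3 has independent products with e1 and e2.\<close>

definition sq_mult_rank_le1 :: "('n::finite) alg \<Rightarrow> bool" where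
  "sq_mult_rank_le1 \<mu> \<longleftrightarrow> (\<forall>f h x y z w. linear_form f \<longrightarrow> linear_form h \<longrightarrow>
     f (\<mu> (\<mu> x y) z) * h (\<mu> (\<mu> x y) w) - f (\<mu> (\<mu> x y) w) * h (\<mu> (\<mu> x y) z) = 0)"

section \<open>Inheritance of the closed conditions by limits\<close>

context
  fixes \<mu> \<nu> :: "('n::finite) alg"
  assumes \<mu>: "\<mu> \<in> algebras" and deg: "\<mu> \<leadsto> \<nu>"
begin

lemma sq_zero_degenerates: "sq_zero \<mu> \<Longrightarrow> sq_zero \<nu>"
proof (rule closed_invariant[OF \<mu> deg, of sq_zero UNIV "\<lambda>(x, y, k) \<mu>. \<mu> x y $ k"])
  show "sq_zero \<sigma>" if "\<mu> \<cong>\<^sub>a \<sigma>" "sq_zero \<mu>" for \<sigma>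
    by (rule alg_isoE[OF that(1)]) (use that(2) in \<open>simp add: sq_zero_def\<close>)
  show "poly_on ((\<lambda>(x, y, k) \<mu>. \<mu> x y $ k) s)" for s :: "(complex ^ 'n) \<times> (complex ^ 'n) \<times> 'n"
    by (cases s, simp only: prod.case) (intro poly_intros)
qed (auto simp: sq_zero_def vec_eq_iff)

lemma class_le2_degenerates: "class_le2 \<mu> \<Longrightarrow> class_le2 \<nu>"
proof (rule closed_invariant[OF \<mu> deg, of class_le2 UNIV "\<lambda>(x, y, z, k) \<mu>. \<mu> (\<mu> x y) z $ k"])
  show "class_le2 \<sigma>" if "\<mu> \<cong>\<^sub>a \<sigma>" "class_le2 \<mu>" for \<sigma>
    by (rule alg_isoE[OF that(1)]) (use that(2) in \<open>simp add: class_le2_def\<close>)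
  show "poly_on ((\<lambda>(x, y, z, k) \<mu>. \<mu> (\<mu> x y) z $ k) s)"
    for s :: "(complex ^ 'n) \<times> (complex ^ 'n) \<times> (complex ^ 'n) \<times> 'n"
    by (cases s, simp only: prod.case) (intro poly_intros)
qed (auto simp: class_le2_def vec_eq_iff)

lemma class_le3_degenerates: "class_le3 \<mu> \<Longrightarrow> class_le3 \<nu>"
proof (rule closed_invariant[OF \<mu> deg, of class_le3 UNIV "\<lambda>(x, y, z, w, k) \<mu>. \<mu> (\<mu> (\<mu> x y) z) w $ k"])
  show "class_le3 \<sigma>" if "\<mu> \<cong>\<^sub>a \<sigma>" "class_le3 \<mu>" for \<sigma>
    by (rule alg_isoE[OF that(1)]) (use that(2) in \<open>simp add: class_le3_def\<close>)
  show "poly_on ((\<lambda>(x, y, z, w, k) \<mu>. \<mu> (\<mu> (\<mu> x y) z) w $ k) s)"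
    for s :: "(complex ^ 'n) \<times> (complex ^ 'n) \<times> (complex ^ 'n) \<times> (complex ^ 'n) \<times> 'n"
    by (cases s, simp only: prod.case) (intro poly_intros)
qed (auto simp: class_le3_def vec_eq_iff)

lemma class_le4_degenerates: "class_le4 \<mu> \<Longrightarrow> class_le4 \<nu>"
proof (rule closed_invariant[OF \<mu> deg, of class_le4 UNIV
      "\<lambda>(x, y, z, v, w, k) \<mu>. \<mu> x (\<mu> y (\<mu> z (\<mu> v w))) $ k"])
  show "class_le4 \<sigma>" if "\<mu> \<cong>\<^sub>a \<sigma>" "class_le4 \<mu>" for \<sigma>
    by (rule alg_isoE[OF that(1)]) (use that(2) in \<open>simp add: class_le4_def\<close>)
  show "poly_on ((\<lambda>(x, y, z, v, w, k) \<mu>. \<mu> x (\<mu> y (\<mu> z (\<mu> v w))) $ k) s)"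
    for s :: "(complex ^ 'n) \<times> (complex ^ 'n) \<times> (complex ^ 'n) \<times> (complex ^ 'n) \<times> (complex ^ 'n) \<times> 'n"
    by (cases s, simp only: prod.case) (intro poly_intros)
qed (auto simp: class_le4_def vec_eq_iff)

lemma jacobi_degenerates: "jacobi \<mu> \<Longrightarrow> jacobi \<nu>"
proof (rule closed_invariant[OF \<mu> deg, of jacobi UNIV "\<lambda>(x, y, z, k) \<mu>. jacobian \<mu> x y z $ k"])
  show "jacobi \<sigma>" if "\<mu> \<cong>\<^sub>a \<sigma>" "jacobi \<mu>" for \<sigma>
  proof (rule alg_isoE[OF that(1)])
    fix f g assume "\<And>x y. f (x + y) = f x + f y" "f 0 = 0" "\<And>x. g (f x) = x"
      "\<sigma> = (\<lambda>x y. f (\<mu> (g x) (g y)))"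
    then have "jacobian \<sigma> x y z = f (jacobian \<mu> (g x) (g y) (g z))" "f 0 = 0" for x y z
      by (simp_all add: jacobian_def)
    then show ?thesis using that(2) by (simp add: jacobi_def)
  qed
  show "poly_on ((\<lambda>(x, y, z, k) \<mu>. jacobian \<mu> x y z $ k) s)"
    for s :: "(complex ^ 'n) \<times> (complex ^ 'n) \<times> (complex ^ 'n) \<times> 'n"
    unfolding jacobian_def by (cases s, simp only: prod.case) (intro poly_intros)
qed (auto simp: jacobi_def vec_eq_iff)

lemma malcev_degenerates:
  assumes "malcev \<mu>" shows "malcev \<nu>"
proof -
  have ac: "\<mu> x y + \<mu> y x = 0" for x y
    using assms by (metis malcev_def add.commute add.right_inverse)
  let ?I = "\<lambda>\<mu>. \<forall>x y. \<mu> x y + \<mu> y x = 0"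
  have "?I \<nu>"
  proof (rule closed_invariant[OF \<mu> deg, of ?I UNIV "\<lambda>(x, y, k) \<mu>. (\<mu> x y + \<mu> y x) $ k"])
    show "?I \<mu>" using ac by blast
    show "?I \<sigma>" if iso: "\<mu> \<cong>\<^sub>a \<sigma>" and \<mu>: "?I \<mu>" for \<sigma>
    proof (rule alg_isoE[OF iso])
      fix f g assume f: "\<And>x y. f (x + y) = f x + f y" "f 0 = 0" "\<sigma> = (\<lambda>x y. f (\<mu> (g x) (g y)))"
      show "?I \<sigma>" unfolding f(3) f(1)[symmetric] using \<mu> f(2) by simp
    qed
    show "poly_on ((\<lambda>(x, y, k) \<mu>. (\<mu> x y + \<mu> y x) $ k) s)" for s :: "(complex ^ 'n) \<times> (complex ^ 'n) \<times> 'n"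
      by (cases s, simp only: prod.case) (intro poly_intros)
  qed (simp only: vec_eq_iff ball_UNIV split_paired_All prod.case zero_index)
  then have 1: "\<nu> x y = - \<nu> y x" for x y
    unfolding eq_neg_iff_add_eq_0 by blast
  have diff0: "a = b \<longleftrightarrow> (\<forall>k. (a - b) $ k = 0)" for a b :: "complex ^ 'n"
    by (simp add: vec_eq_iff)
  let ?J = "\<lambda>\<mu>. \<forall>x y z. jacobian \<mu> x y (\<mu> x z) = \<mu> (jacobian \<mu> x y z) x"
  have 2: "?J \<nu>"
  proof (rule closed_invariant[OF \<mu> deg, of ?J UNIV
      "\<lambda>(x, y, z, k) \<mu>. (jacobian \<mu> x y (\<mu> x z) - \<mu> (jacobian \<mu> x y z) x) $ k"])
    show "?J \<mu>" using assms unfolding malcev_def by blast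
    show "?J \<sigma>" if iso: "\<mu> \<cong>\<^sub>a \<sigma>" and J: "?J \<mu>" for \<sigma>
    proof (rule alg_isoE[OF iso])
      fix f g assume f: "\<And>x y. f (x + y) = f x + f y" "\<And>x. g (f x) = x"
        "\<sigma> = (\<lambda>x y. f (\<mu> (g x) (g y)))"
      have j: "jacobian \<sigma> x y z = f (jacobian \<mu> (g x) (g y) (g z))" for x y z
        by (simp add: jacobian_def f)
      show "?J \<sigma>" unfolding j unfolding f(3) f(2) using J by simp
    qed
    show "poly_on ((\<lambda>(x, y, z, k) \<mu>. (jacobian \<mu> x y (\<mu> x z) - \<mu> (jacobian \<mu> x y z) x) $ k) s)"
      for s :: "(complex ^ 'n) \<times> (complex ^ 'n) \<times> (complex ^ 'n) \<times> 'n"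
      unfolding jacobian_def by (cases s, simp only: prod.case) (intro poly_intros)
  qed (simp only: diff0 ball_UNIV split_paired_All prod.case)
  show ?thesis
    unfolding malcev_def using 1 2 degenerates_in_algebras[OF \<mu> deg] by blast
qed

lemma sq_dim_le1_degenerates: "sq_dim_le1 \<mu> \<Longrightarrow> sq_dim_le1 \<nu>"
proof (rule closed_invariant[OF \<mu> deg, of sq_dim_le1 "{(f, h, x, y, z, w). linear_form f \<and> linear_form h}"
      "\<lambda>(f, h, x, y, z, w) \<mu>. f (\<mu> x y) * h (\<mu> z w) - f (\<mu> z w) * h (\<mu> x y)"])
  show "sq_dim_le1 \<sigma>" if "\<mu> \<cong>\<^sub>a \<sigma>" "sq_dim_le1 \<mu>" for \<sigma>
  proof (rule alg_isoE[OF that(1)])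
    fix f g assume f: "\<And>x y. f (x + y) = f x + f y" "\<And>c x. f (c *s x) = c *s f x"
      and \<sigma>: "\<sigma> = (\<lambda>x y. f (\<mu> (g x) (g y)))"
    show ?thesis
      unfolding sq_dim_le1_def \<sigma>
      by (intro allI impI that(2)[unfolded sq_dim_le1_def, rule_format]
          linear_form_comp[of _ f] f)
  qed
qed (auto simp: sq_dim_le1_def intro!: poly_intros)

lemma sq_dim_le2_degenerates: "sq_dim_le2 \<mu> \<Longrightarrow> sq_dim_le2 \<nu>"
proof (rule closed_invariant[OF \<mu> deg, of sq_dim_le2
      "{(f, g, h, x, y, z, w, u, v). linear_form f \<and> linear_form g \<and> linear_form h}"
      "\<lambda>(f, g, h, x, y, z, w, u, v) \<mu>.
         f (\<mu> x y) * (g (\<mu> z w) * h (\<mu> u v) - g (\<mu> u v) * h (\<mu> z w))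
         - f (\<mu> z w) * (g (\<mu> x y) * h (\<mu> u v) - g (\<mu> u v) * h (\<mu> x y))
         + f (\<mu> u v) * (g (\<mu> x y) * h (\<mu> z w) - g (\<mu> z w) * h (\<mu> x y))"])
  show "sq_dim_le2 \<sigma>" if "\<mu> \<cong>\<^sub>a \<sigma>" "sq_dim_le2 \<mu>" for \<sigma>
  proof (rule alg_isoE[OF that(1)])
    fix f g assume f: "\<And>x y. f (x + y) = f x + f y" "\<And>c x. f (c *s x) = c *s f x"
      and \<sigma>: "\<sigma> = (\<lambda>x y. f (\<mu> (g x) (g y)))"
    show ?thesis
      unfolding sq_dim_le2_def \<sigma>
      by (intro allI impI that(2)[unfolded sq_dim_le2_def, rule_format]
          linear_form_comp[of _ f] f)
  qed
qed (auto simp: sq_dim_le2_def intro!: poly_intros)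

lemma forms_decomposable_degenerates: "forms_decomposable \<mu> \<Longrightarrow> forms_decomposable \<nu>"
proof (rule closed_invariant[OF \<mu> deg, of forms_decomposable "{(f, x, y, z, w). linear_form f}"
      "\<lambda>(f, x, y, z, w) \<mu>. f (\<mu> x y) * f (\<mu> z w) - f (\<mu> x z) * f (\<mu> y w) + f (\<mu> x w) * f (\<mu> y z)"])
  show "forms_decomposable \<sigma>" if "\<mu> \<cong>\<^sub>a \<sigma>" "forms_decomposable \<mu>" for \<sigma>
  proof (rule alg_isoE[OF that(1)])
    fix f g assume f: "\<And>x y. f (x + y) = f x + f y" "\<And>c x. f (c *s x) = c *s f x"
      and \<sigma>: "\<sigma> = (\<lambda>x y. f (\<mu> (g x) (g y)))"
    show ?thesis
      unfolding forms_decomposable_def \<sigma>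
      by (intro allI impI that(2)[unfolded forms_decomposable_def, rule_format]
          linear_form_comp[of _ f] f)
  qed
qed (auto simp: forms_decomposable_def intro!: poly_intros)

lemma sq_mult_rank_le1_degenerates: "sq_mult_rank_le1 \<mu> \<Longrightarrow> sq_mult_rank_le1 \<nu>"
proof (rule closed_invariant[OF \<mu> deg, of sq_mult_rank_le1
      "{(f, h, x, y, z, w). linear_form f \<and> linear_form h}"
      "\<lambda>(f, h, x, y, z, w) \<mu>. f (\<mu> (\<mu> x y) z) * h (\<mu> (\<mu> x y) w) - f (\<mu> (\<mu> x y) w) * h (\<mu> (\<mu> x y) z)"])
  show "sq_mult_rank_le1 \<sigma>" if "\<mu> \<cong>\<^sub>a \<sigma>" "sq_mult_rank_le1 \<mu>" for \<sigma>
  proof (rule alg_isoE[OF that(1)])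
    fix f g assume f: "\<And>x y. f (x + y) = f x + f y" "\<And>c x. f (c *s x) = c *s f x"
      and gf: "\<And>x. g (f x) = x" and \<sigma>: "\<sigma> = (\<lambda>x y. f (\<mu> (g x) (g y)))"
    show ?thesis
      unfolding sq_mult_rank_le1_def \<sigma> gf
      by (intro allI impI that(2)[unfolded sq_mult_rank_le1_def, rule_format]
          linear_form_comp[of _ f] f)
  qed
qed (auto simp: sq_mult_rank_le1_def intro!: poly_intros)

end

section \<open>Values of the invariants on the ten algebras\<close>

lemma linear_form_vec5:
  assumes "linear_form f"
  shows "f (vec5 a b c d e) = a * f (axis 1 1) + b * f (axis 2 1) + c * f (axis 3 1)
    + d * f (axis 4 1) + e * f (axis 5 1)"
proof -
  have "f (x + y) = f x + f y" for x y using assms by (simp add: linear_form_def)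
  then show ?thesis by (simp only: linear_form_axis[OF assms, of _ a] linear_form_axis[OF assms, of _ b]
        linear_form_axis[OF assms, of _ c] linear_form_axis[OF assms, of _ d] linear_form_axis[OF assms, of _ e])
qed

lemma sq_zero_table: "sq_zero C5" "\<not> sq_zero n3_C2" "\<not> sq_zero n4_C" "\<not> sq_zero g51" "\<not> sq_zero g52"
  "\<not> sq_zero g53" "\<not> sq_zero g54" "\<not> sq_zero g55" "\<not> sq_zero g56" "\<not> sq_zero M5"
proof -
  show "sq_zero C5" by (simp add: sq_zero_def coord_simps)
  have *: "\<not> sq_zero \<mu>" if "\<mu> (axis 1 1) (axis 2 1) \<noteq> 0" for \<mu> :: "5 alg"
    using that unfolding sq_zero_def by blast
  show "\<not> sq_zero n3_C2" "\<not> sq_zero n4_C" "\<not> sq_zero g51" "\<not> sq_zero g52"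
    "\<not> sq_zero g53" "\<not> sq_zero g54" "\<not> sq_zero g55" "\<not> sq_zero g56" "\<not> sq_zero M5"
    by (rule *, simp add: coord_simps)+
qed

lemma sq_dim_le1_table: "sq_dim_le1 n3_C2" "sq_dim_le1 g51" "\<not> sq_dim_le1 n4_C" "\<not> sq_dim_le1 g52"
  "\<not> sq_dim_le1 g53" "\<not> sq_dim_le1 g54" "\<not> sq_dim_le1 g55" "\<not> sq_dim_le1 g56" "\<not> sq_dim_le1 M5"
proof -
  show "sq_dim_le1 n3_C2" "sq_dim_le1 g51"
    unfolding sq_dim_le1_def table_alg_mult by (intro allI impI, simp only: linear_form_vec5, simp)+
  have *: "\<not> sq_dim_le1 \<mu>"
    if "\<mu> (axis 1 1) (axis 2 1) $ i * \<mu> (axis a 1) (axis b 1) $ j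
      - \<mu> (axis a 1) (axis b 1) $ i * \<mu> (axis 1 1) (axis 2 1) $ j \<noteq> 0" for a b i j :: 5 and \<mu> :: "5 alg"
    using that linear_form_nth[of i] linear_form_nth[of j] unfolding sq_dim_le1_def by blast
  show "\<not> sq_dim_le1 n4_C" by (rule *[where i = 3 and j = 4 and a = 1 and b = 3]) (simp add: coord_simps)
  show "\<not> sq_dim_le1 g52" by (rule *[where i = 4 and j = 5 and a = 1 and b = 3]) (simp add: coord_simps)
  show "\<not> sq_dim_le1 g53" by (rule *[where i = 3 and j = 5 and a = 1 and b = 4]) (simp add: coord_simps)
  show "\<not> sq_dim_le1 g54" by (rule *[where i = 3 and j = 4 and a = 1 and b = 3]) (simp add: coord_simps)
  show "\<not> sq_dim_le1 g55" by (rule *[where i = 3 and j = 4 and a = 1 and b = 3]) (simp add: coord_simps)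
  show "\<not> sq_dim_le1 g56" by (rule *[where i = 3 and j = 4 and a = 1 and b = 3]) (simp add: coord_simps)
  show "\<not> sq_dim_le1 M5" by (rule *[where i = 4 and j = 5 and a = 3 and b = 4]) (simp add: coord_simps)
qed

lemma sq_dim_le2_table: "sq_dim_le2 n4_C" "sq_dim_le2 g53" "sq_dim_le2 M5"
  "\<not> sq_dim_le2 g54" "\<not> sq_dim_le2 g55" "\<not> sq_dim_le2 g56"
proof -
  show "sq_dim_le2 n4_C" "sq_dim_le2 g53" "sq_dim_le2 M5"
    unfolding sq_dim_le2_def table_alg_mult
    by (intro allI impI, simp only: linear_form_vec5 mult_zero_left add_0_left add_0_right, algebra)+
  have *: "\<not> sq_dim_le2 \<mu>" if "let p = \<mu> (axis 1 1) (axis 2 1); q = \<mu> (axis 1 1) (axis 3 1);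
      r = \<mu> (axis a 1) (axis b 1) in p $ 3 * (q $ 4 * r $ 5 - r $ 4 * q $ 5)
        - q $ 3 * (p $ 4 * r $ 5 - r $ 4 * p $ 5) + r $ 3 * (p $ 4 * q $ 5 - q $ 4 * p $ 5) \<noteq> 0"
    for a b :: 5 and \<mu> :: "5 alg"
  proof
    assume "sq_dim_le2 \<mu>"
    from this[unfolded sq_dim_le2_def, rule_format, OF linear_form_nth[of 3] linear_form_nth[of 4]
        linear_form_nth[of 5]] that show False unfolding Let_def by blast
  qed
  show "\<not> sq_dim_le2 g54" by (rule *[where a = 2 and b = 3]) (simp add: coord_simps)
  show "\<not> sq_dim_le2 g55" "\<not> sq_dim_le2 g56"
    by (rule *[where a = 1 and b = 4], simp add: coord_simps)+
qed

lemma class_le2_table: "class_le2 g51" "class_le2 g52" "\<not> class_le2 n4_C" "\<not> class_le2 g53"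
  "\<not> class_le2 g54" "\<not> class_le2 g55" "\<not> class_le2 g56" "\<not> class_le2 M5"
proof -
  show "class_le2 g51" "class_le2 g52" by (simp_all add: class_le2_def coord_simps)
  have *: "\<not> class_le2 \<mu>" if "\<mu> (\<mu> (axis 1 1) (axis 2 1)) (axis a 1) \<noteq> 0" for a :: 5 and \<mu> :: "5 alg"
    using that unfolding class_le2_def by blast
  show "\<not> class_le2 n4_C" "\<not> class_le2 g54" "\<not> class_le2 g55" "\<not> class_le2 g56"
    by (rule *[where a = 1], simp add: coord_simps)+
  show "\<not> class_le2 g53" by (rule *[where a = 2]) (simp add: coord_simps)
  show "\<not> class_le2 M5" by (rule *[where a = 3]) (simp add: coord_simps)
qed

lemma class_le3_table: "class_le3 g54" "\<not> class_le3 g55"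
proof -
  show "class_le3 g54" by (simp add: class_le3_def coord_simps)
  have "g55 (g55 (g55 (axis 1 1) (axis 2 1)) (axis 1 1)) (axis 1 1) \<noteq> 0"
    by (simp add: coord_simps)
  then show "\<not> class_le3 g55" unfolding class_le3_def by blast
qed

text \<open>For \<open>n4_C\<close>, \<open>g52\<close> and \<open>g55\<close> all forms share the
  first coordinate as a factor, for \<open>n3_C2\<close> there is only one form up to scalars, and
  for \<open>g54\<close> the forms live in three variables, where every alternating form is
  decomposable.\<close>

lemma forms_decomposable_table: "forms_decomposable n3_C2" "forms_decomposable n4_C"
  "forms_decomposable g52" "forms_decomposable g54" "forms_decomposable g55"
  "\<not> forms_decomposable g51" "\<not> forms_decomposable g53" "\<not> forms_decomposable g56" "\<not> forms_decomposable M5"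
proof -
  show "forms_decomposable n3_C2" "forms_decomposable n4_C" "forms_decomposable g52"
    "forms_decomposable g54" "forms_decomposable g55"
    unfolding forms_decomposable_def table_alg_mult
    by (intro allI impI, simp only: linear_form_vec5 mult_zero_left add_0_left add_0_right, algebra)+
  have *: "\<not> forms_decomposable \<mu>" if "linear_form f" "f (\<mu> (axis 1 1) (axis 2 1)) * f (\<mu> (axis 3 1) (axis 4 1))
      - f (\<mu> (axis 1 1) (axis 3 1)) * f (\<mu> (axis 2 1) (axis 4 1))
      + f (\<mu> (axis 1 1) (axis 4 1)) * f (\<mu> (axis 2 1) (axis 3 1)) \<noteq> 0" for f and \<mu> :: "5 alg"
    using that unfolding forms_decomposable_def by blast
  show "\<not> forms_decomposable g51" "\<not> forms_decomposable g53" "\<not> forms_decomposable g56"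
    by (rule *[OF linear_form_nth[of 5]], simp add: coord_simps)+
  \<comment> \<open>Each coordinate of \<open>M5\<close> alone has rank two; adding the last two
    pairs e1 with e2 and e3 with e4 at the same time.\<close>
  have "linear_form (\<lambda>v :: complex ^ 5. v $ 4 + v $ 5)"
    by (simp add: linear_form_def algebra_simps)
  then show "\<not> forms_decomposable M5"
    by (rule *) (simp add: coord_simps)
qed

lemma sq_mult_rank_le1_table: "sq_mult_rank_le1 g55" "\<not> sq_mult_rank_le1 g54"
proof -
  show "sq_mult_rank_le1 g55"
    unfolding sq_mult_rank_le1_def table_alg_mult
    by (intro allI impI, simp only: linear_form_vec5) (simp add: axis_nth_if algebra_simps)
  show "\<not> sq_mult_rank_le1 g54"
  proof
    assume "sq_mult_rank_le1 g54"
    from this[unfolded sq_mult_rank_le1_def, rule_format, OF linear_form_nth[of 4] linear_form_nth[of 5],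
        of "axis 1 1" "axis 2 1" "axis 1 1" "axis 2 1"]
    show False by (simp add: coord_simps)
  qed
qed

lemma jacobi_table: "jacobi C5" "jacobi n3_C2" "jacobi n4_C" "jacobi g51" "jacobi g52" "jacobi g53"
  "jacobi g54" "jacobi g55" "jacobi g56" "\<not> jacobi M5"
proof -
  show "jacobi C5" "jacobi n3_C2" "jacobi n4_C" "jacobi g51" "jacobi g52" "jacobi g53"
    "jacobi g54" "jacobi g55" "jacobi g56"
    by (simp_all add: jacobi_def jacobian_def coord_simps algebra_simps)
  have "jacobian M5 (axis 1 1) (axis 2 1) (axis 3 1) \<noteq> 0"
    by (simp add: jacobian_def coord_simps)
  then show "\<not> jacobi M5" unfolding jacobi_def by blast
qed

lemma class_le4_table: "class_le4 C5" "class_le4 n3_C2" "class_le4 n4_C" "class_le4 g51" "class_le4 g52"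
  "class_le4 g53" "class_le4 g54" "class_le4 g55" "class_le4 g56" "class_le4 M5"
  by (simp_all add: class_le4_def coord_simps)

section \<open>The ten algebras are nilpotent Malcev algebras\<close>

text \<open>When the Jacobian vanishes, both sides of the Malcev identity are zero. This covers all
  of the table except \<open>M5\<close>.\<close>

lemma malcev_jacobi:
  assumes "\<mu> \<in> algebras" "\<And>x y. \<mu> x y = - \<mu> y x" "jacobi \<mu>" shows "malcev \<mu>"
proof -
  have "jacobian \<mu> x y z = 0" for x y z using assms(3) by (simp add: jacobi_def)
  then show ?thesis unfolding malcev_def
    by (intro conjI allI assms(1,2)) (simp only: alg_zero_left[OF assms(1)])
qed

lemma malcev_table: "malcev C5" "malcev n3_C2" "malcev n4_C" "malcev g51" "malcev g52"
  "malcev g53" "malcev g54" "malcev g55" "malcev g56" "malcev M5"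
proof -
  show "malcev C5" "malcev n3_C2" "malcev n4_C" "malcev g51" "malcev g52"
    "malcev g53" "malcev g54" "malcev g55" "malcev g56"
    by (rule malcev_jacobi; (fact table_in_algebras jacobi_table)?;
      simp add: coord_simps)+
  have "jacobian M5 x y (M5 x z) = M5 (jacobian M5 x y z) x" for x y z
    by (simp add: jacobian_def coord_simps)
  moreover have "M5 x y = - M5 y x" for x y
    by (simp add: coord_simps)
  ultimately show "malcev M5" unfolding malcev_def using table_in_algebras by blast
qed

text \<open>A weight w with w i + w j \<le> w k for every e_i e_j = e_k gives a filtration: the n-th
  power lies in the span of the basis vectors of weight at least n, which is zero once n exceeds the
  largest weight.\<close>

lemma nilpotent_table_alg:
  fixes w :: "5 \<Rightarrow> nat"
  assumes fin: "finite T" and w: "\<And>i j k. (i, j, k) \<in> T \<Longrightarrow> w i + w j \<le> w k"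
    and pos: "\<And>i. w i \<ge> 1"
  shows "nilpotent (table_alg T)"
proof -
  have *: "alg_power (table_alg T) n \<subseteq> {v. \<forall>k. w k < n \<longrightarrow> v $ k = 0}" for n
  proof (induct n rule: less_induct)
    case (less n)
    show ?case
    proof (cases "n \<le> 1")
      case True
      then have "\<not> w k < n" for k using pos[of k] by linarith
      then show ?thesis by simp
    next
      case False
      have "table_alg T x y $ k = 0"
        if i: "i \<in> {1..<n}" and x: "x \<in> alg_power (table_alg T) i"
          and y: "y \<in> alg_power (table_alg T) (n - i)" and k: "w k < n" for i x y k
      proof -
        have x0: "x $ a = 0" if "w a < i" for a using less[of i] i x that by auto
        have y0: "y $ a = 0" if "w a < n - i" for a using less[of "n - i"] i y that by auto
        have "axis c (x $ a * y $ b - x $ b * y $ a) $ k = 0" if "(a, b, c) \<in> T" for a b c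
        proof (cases "c = k")
          case True
          then have "w a + w b < n" using w[OF that] k by simp
          \<comment> \<open>One conjunct for each summand of the antisymmetrised term: in both
            products a factor has too small a weight and vanishes.\<close>
          then have "(w a < i \<or> w b < n - i) \<and> (w b < i \<or> w a < n - i)" by linarith
          then show ?thesis using x0 y0 by (auto simp: axis_nth_if)
        qed (simp add: axis_nth_if)
        then show ?thesis unfolding table_alg_def by (auto intro!: sum.neutral simp: sum_component)
      qed
      moreover have "vec.subspace {v :: complex ^ 5. \<forall>k. w k < n \<longrightarrow> v $ k = 0}"
        by (auto simp: vec.subspace_def)
      ultimately have "vec.span (\<Union>i\<in>{1..<n}. (\<lambda>(x, y). table_alg T x y) `
          (alg_power (table_alg T) i \<times> alg_power (table_alg T) (n - i)))
          \<subseteq> {v. \<forall>k. w k < n \<longrightarrow> v $ k = 0}"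
        by (intro vec.span_minimal) auto
      then show ?thesis
        using False by (subst alg_power.simps) simp
    qed
  qed
  define N where "N = Suc (Max (range w))"
  have "w k < N" for k unfolding N_def by (simp add: less_Suc_eq_le)
  then have "alg_power (table_alg T) N \<subseteq> {0}" using *[of N] by (auto simp: vec_eq_iff)
  moreover have "0 \<in> alg_power (table_alg T) N" by (subst alg_power.simps) (simp add: vec.span_zero)
  ultimately show ?thesis unfolding nilpotent_def N_def by (intro exI[of _ N]) (auto simp: N_def)
qed

lemma nilpotent_table: "nilpotent C5" "nilpotent n3_C2" "nilpotent n4_C" "nilpotent g51" "nilpotent g52"
  "nilpotent g53" "nilpotent g54" "nilpotent g55" "nilpotent g56" "nilpotent M5"
proof -
  \<comment> \<open>Giving e_i the weight i works as long as i + j \<le> k in every triple. The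
    product e3 e4 = e5 of \<open>g51\<close> and \<open>M5\<close> violates this, so these two
    receive weights of their own.\<close>
  define w :: "5 \<Rightarrow> nat" where
    "w i = (if i = 1 then 1 else if i = 2 then 2 else if i = 3 then 3 else if i = 4 then 4 else 5)" for i
  show "nilpotent C5" "nilpotent n3_C2" "nilpotent n4_C" "nilpotent g52"
    "nilpotent g53" "nilpotent g54" "nilpotent g55" "nilpotent g56"
    unfolding table_defs
    by (rule nilpotent_table_alg[where w = w]; auto simp: w_def)+
  show "nilpotent g51"
    unfolding table_defs
    by (rule nilpotent_table_alg[where w = "\<lambda>i. if i = 5 then 2 else 1"]) auto
  show "nilpotent M5"
    unfolding table_defs
    by (rule nilpotent_table_alg[where w = "\<lambda>i. if i = 4 then 2 else if i = 5 then 3 else 1"]) auto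
qed

lemma table_in_nilpotent_malcev:
  "C5 \<in> nilpotent_malcev" "n3_C2 \<in> nilpotent_malcev" "n4_C \<in> nilpotent_malcev"
  "g51 \<in> nilpotent_malcev" "g52 \<in> nilpotent_malcev" "g53 \<in> nilpotent_malcev" "g54 \<in> nilpotent_malcev"
  "g55 \<in> nilpotent_malcev" "g56 \<in> nilpotent_malcev" "M5 \<in> nilpotent_malcev"
  by (simp_all add: nilpotent_malcev_def malcev_table nilpotent_table)

subsection \<open>The lower central series\<close>

text \<open>Numbered from 0, so \<open>lcs \<mu> k\<close> corresponds to the usual term number k +
  1, and \<open>lcs \<mu> 1\<close> is the square of the algebra.\<close>

fun lcs :: "('n::finite) alg \<Rightarrow> nat \<Rightarrow> (complex ^ 'n) set" where
  "lcs \<mu> 0 = UNIV"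
| "lcs \<mu> (Suc k) = vec.span {\<mu> x y | x y. y \<in> lcs \<mu> k}"

lemma subspace_lcs: "vec.subspace (lcs \<mu> k)"
  by (cases k) (simp_all add: vec.subspace_span)

lemma lcs_mult: "y \<in> lcs \<mu> k \<Longrightarrow> \<mu> x y \<in> lcs \<mu> (Suc k)"
  by (auto intro: vec.span_base)

lemma lcs_Suc_subset: "lcs \<mu> (Suc k) \<subseteq> lcs \<mu> k"
proof (induct k)
  case (Suc k)
  then show ?case by (auto intro!: vec.span_mono simp del: lcs.simps simp: lcs.simps(2))
qed simp

text \<open>Only the summand i = 1 of the power is used, a product with an arbitrary left
  factor.\<close>

lemma lcs_subset_alg_power: "lcs \<mu> k \<subseteq> alg_power \<mu> (Suc k)"
proof (induct k)
  case 0
  then show ?case by (subst alg_power.simps) simp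
next
  case (Suc k)
  have "alg_power \<mu> 1 = UNIV" by (subst alg_power.simps) simp
  with Suc have "{\<mu> x y | x y. y \<in> lcs \<mu> k} \<subseteq>
      (\<lambda>(x, y). \<mu> x y) ` (alg_power \<mu> 1 \<times> alg_power \<mu> (Suc (Suc k) - 1))"
    by auto
  also have "\<dots> \<subseteq> (\<Union>i\<in>{1..<Suc (Suc k)}. (\<lambda>(x, y). \<mu> x y) ` (alg_power \<mu> i \<times> alg_power \<mu> (Suc (Suc k) - i)))"
    by (intro UN_upper) simp
  finally show ?case
    by (subst alg_power.simps) (simp add: vec.span_mono)
qed

lemma nilpotent_imp_lcs: "nilpotent \<mu> \<Longrightarrow> \<exists>k. lcs \<mu> k = {0}"
proof -
  assume "nilpotent \<mu>"
  then obtain n where "n \<ge> 1" "alg_power \<mu> n = {0}" unfolding nilpotent_def by blast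
  then have "lcs \<mu> (n - 1) \<subseteq> {0}" using lcs_subset_alg_power[of \<mu> "n - 1"] by simp
  then show ?thesis using vec.subspace_0[OF subspace_lcs, of \<mu>] by (metis empty_iff subset_singletonD)
qed

lemma lcs_Suc_subsetI:
  assumes "vec.subspace S" "\<And>x y. y \<in> lcs \<mu> k \<Longrightarrow> \<mu> x y \<in> S" shows "lcs \<mu> (Suc k) \<subseteq> S"
  unfolding lcs.simps by (rule vec.span_minimal) (use assms in auto)

lemma subspace_zeros_left: "\<mu> \<in> algebras \<Longrightarrow> vec.subspace {y. \<mu> x y = 0}"
  by (auto simp: vec.subspace_def alg_bilinear)

text \<open>Each annihilation condition cuts out a subspace, so it passes from products to their
  span; one factor is peeled off at each of the four stages.\<close>

lemma class_le4_imp_lcs: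
  assumes \<mu>: "\<mu> \<in> algebras" and c: "class_le4 \<mu>" shows "\<exists>k. lcs \<mu> k = {0}"
proof -
  have sub: "vec.subspace {u. \<forall>x. \<mu> x u = 0}" "vec.subspace {u. \<forall>y x. \<mu> y (\<mu> x u) = 0}"
    "vec.subspace {u. \<forall>z y x. \<mu> z (\<mu> y (\<mu> x u)) = 0}"
    using \<mu> by (auto simp: vec.subspace_def alg_bilinear)
  have "lcs \<mu> (Suc 0) \<subseteq> {u. \<forall>z y x. \<mu> z (\<mu> y (\<mu> x u)) = 0}"
    by (rule lcs_Suc_subsetI[OF sub(3)]) (use c in \<open>auto simp: class_le4_def\<close>)
  then have "lcs \<mu> (Suc (Suc 0)) \<subseteq> {u. \<forall>y x. \<mu> y (\<mu> x u) = 0}"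
    by (intro lcs_Suc_subsetI[OF sub(2)]) blast
  then have "lcs \<mu> (Suc (Suc (Suc 0))) \<subseteq> {u. \<forall>x. \<mu> x u = 0}"
    by (intro lcs_Suc_subsetI[OF sub(1)]) blast
  then have "lcs \<mu> (Suc (Suc (Suc (Suc 0)))) \<subseteq> {0}"
    by (intro lcs_Suc_subsetI[OF vec.subspace_single_0]) blast
  then show ?thesis using vec.subspace_0[OF subspace_lcs, of \<mu>] by (metis empty_iff subset_singletonD)
qed

text \<open>Each term determines the next, so a series that repeats once is constant from there on
  and equals its eventual value zero.\<close>

lemma lcs_stationary:
  assumes "\<mu> \<in> algebras" "\<exists>k. lcs \<mu> k = {0}" "lcs \<mu> (Suc j) = lcs \<mu> j" shows "lcs \<mu> j = {0}"
proof -
  have st: "lcs \<mu> (j + i) = lcs \<mu> j" for i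
  proof (induct i)
    case (Suc i)
    have "lcs \<mu> (j + Suc i) = vec.span {\<mu> x y | x y. y \<in> lcs \<mu> (j + i)}" by simp
    then show ?case using Suc assms(3) by simp
  qed simp
  obtain k where k: "lcs \<mu> k = {0}" using assms(2) by blast
  have "lcs \<mu> (k + i) \<subseteq> lcs \<mu> k" for i
    by (induct i) (use lcs_Suc_subset in \<open>auto simp del: lcs.simps\<close>)
  then have "lcs \<mu> (j + k) \<subseteq> {0}" using k by (metis add.commute)
  then have "lcs \<mu> j \<subseteq> {0}" using st by simp
  then show ?thesis using vec.subspace_0[OF subspace_lcs, of \<mu>] by (metis empty_iff subset_singletonD)
qed

lemma dim_lcs_Suc_less:
  assumes "\<mu> \<in> algebras" "\<exists>k. lcs \<mu> k = {0}" "lcs \<mu> j \<noteq> {0}"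
  shows "vec.dim (lcs \<mu> (Suc j)) < vec.dim (lcs \<mu> j)"
proof (rule ccontr)
  assume "\<not> ?thesis"
  then have "lcs \<mu> (Suc j) = lcs \<mu> j"
    by (intro vec.subspace_dim_equal subspace_lcs lcs_Suc_subset) simp
  then show False using lcs_stationary assms by blast
qed

section \<open>Codimension one and completion to a basis\<close>

lemma subspace_dim_0: "vec.subspace S \<Longrightarrow> vec.dim S = 0 \<longleftrightarrow> S = {0}"
  using vec.subspace_0[of S] by (auto simp: vec.dim_eq_0)

text \<open>W / U has dimension at most one, so any w outside U spans the quotient. Applied to
  consecutive terms of the lower central series, this produces normal forms for products.\<close>

lemma subspace_dim_Suc_decomp:
  fixes U W :: "(complex ^ 'n) set"
  assumes "vec.subspace U" "vec.subspace W" "U \<subseteq> W" "vec.dim W \<le> Suc (vec.dim U)" "w \<in> W" "w \<notin> U"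
    and "v \<in> W"
  obtains a where "v - a *s w \<in> U"
proof -
  have U: "vec.span U = U" using assms(1) by (simp add: vec.span_eq_iff)
  have "vec.span (insert w U) = W"
  proof (rule vec.subspace_dim_equal)
    show "vec.dim W \<le> vec.dim (vec.span (insert w U))"
      using assms(4,6) by (simp add: vec.dim_insert U)
    show "vec.span (insert w U) \<subseteq> W" using assms(2,3,5) by (intro vec.span_minimal) auto
  qed (simp_all add: assms)
  then have "v \<in> vec.span (insert w U)" using assms(7) by simp
  then show thesis using that U by (auto simp: vec.span_breakdown_eq)
qed

lemma span_eq_UNIV_iff_dim: "vec.span S = UNIV \<longleftrightarrow> vec.dim (S :: (complex ^ 'n) set) = CARD('n)"
proof -
  have U: "vec.dim (UNIV :: (complex ^ 'n) set) = CARD('n)"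
    by (simp add: vec.dimension_def card_cart_basis)
  show ?thesis
  proof
    assume "vec.span S = UNIV"
    then show "vec.dim S = CARD('n)" using U vec.dim_span[of S] by simp
  next
    assume "vec.dim S = CARD('n)"
    then show "vec.span S = UNIV"
      by (intro vec.subspace_dim_equal vec.subspace_span vec.subspace_UNIV) (simp_all only: U vec.dim_span subset_UNIV order_refl)
  qed
qed

lemma extend_span:
  fixes U :: "(complex ^ 'n) set"
  assumes "m \<le> vec.dim U" "m < CARD('n)" shows "\<exists>x. Suc m \<le> vec.dim (insert x U)"
proof (cases "vec.span U = UNIV")
  case True
  then have "vec.dim (insert x U) = CARD('n)" for x
    unfolding span_eq_UNIV_iff_dim[symmetric] using vec.span_mono[of U "insert x U"] by auto
  then show ?thesis using assms by simp
next
  case False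
  then obtain x where "x \<notin> vec.span U" by blast
  then have "vec.dim (insert x U) = Suc (vec.dim U)" by (simp add: vec.dim_insert)
  then show ?thesis using assms by (metis Suc_le_mono)
qed

lemma dim_le_5: "vec.dim (S :: (complex ^ 5) set) \<le> 5"
  using vec.dim_subset_UNIV[of S] by (simp add: vec.dimension_def card_cart_basis)

lemma extend_span5:
  fixes U :: "(complex ^ 5) set"
  shows "4 \<le> vec.dim U \<Longrightarrow> \<exists>x. vec.span (insert x U) = UNIV"
    and "3 \<le> vec.dim U \<Longrightarrow> \<exists>x y. vec.span ({x, y} \<union> U) = UNIV"
    and "2 \<le> vec.dim U \<Longrightarrow> \<exists>x y z. vec.span ({x, y, z} \<union> U) = UNIV"
proof -
  show 1: "\<exists>x. vec.span (insert x U) = UNIV" if d: "4 \<le> vec.dim U" for U :: "(complex ^ 5) set"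
  proof -
    obtain x where "5 \<le> vec.dim (insert x U)" using extend_span[OF d] by auto
    then have "vec.dim (insert x U) = 5" using dim_le_5[of "insert x U"] by linarith
    then show ?thesis unfolding span_eq_UNIV_iff_dim by auto
  qed
  show 2: "\<exists>x y. vec.span ({x, y} \<union> U) = UNIV" if d: "3 \<le> vec.dim U" for U :: "(complex ^ 5) set"
  proof -
    obtain y where "4 \<le> vec.dim (insert y U)" using extend_span[OF d] by auto
    from 1[OF this] show ?thesis by auto
  qed
  show "\<exists>x y z. vec.span ({x, y, z} \<union> U) = UNIV" if d: "2 \<le> vec.dim U" for U :: "(complex ^ 5) set"
  proof -
    obtain z where "3 \<le> vec.dim (insert z U)" using extend_span[OF d] by auto
    from 2[OF this] show ?thesis by auto
  qed
qed

text \<open>Anticommutativity reduces the 25 products of basis vectors to the ten with i <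
  j.\<close>

lemma alg_iso_basis5:
  fixes \<mu> \<nu> :: "5 alg"
  assumes \<mu>: "\<mu> \<in> algebras" and \<nu>: "\<nu> \<in> algebras"
    and acm: "\<And>x y. \<mu> x y = - \<mu> y x" and acn: "\<And>x y. \<nu> x y = - \<nu> y x"
    and sp: "UNIV \<subseteq> vec.span {b1, b2, b3, b4, b5}"
  defines "lc v \<equiv> v $ 1 *s b1 + v $ 2 *s b2 + v $ 3 *s b3 + v $ 4 *s b4 + v $ 5 *s b5"
  assumes "\<mu> b1 b2 = lc (\<nu> (axis 1 1) (axis 2 1))" "\<mu> b1 b3 = lc (\<nu> (axis 1 1) (axis 3 1))"
    "\<mu> b1 b4 = lc (\<nu> (axis 1 1) (axis 4 1))" "\<mu> b1 b5 = lc (\<nu> (axis 1 1) (axis 5 1))"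
    "\<mu> b2 b3 = lc (\<nu> (axis 2 1) (axis 3 1))" "\<mu> b2 b4 = lc (\<nu> (axis 2 1) (axis 4 1))"
    "\<mu> b2 b5 = lc (\<nu> (axis 2 1) (axis 5 1))" "\<mu> b3 b4 = lc (\<nu> (axis 3 1) (axis 4 1))"
    "\<mu> b3 b5 = lc (\<nu> (axis 3 1) (axis 5 1))" "\<mu> b4 b5 = lc (\<nu> (axis 4 1) (axis 5 1))"
  shows "\<nu> \<cong>\<^sub>a \<mu>"
proof -
  define b where "b i = (if i = 1 then b1 else if i = 2 then b2 else if i = 3 then b3
    else if i = 4 then b4 else b5)" for i :: 5
  have b: "b 1 = b1" "b 2 = b2" "b 3 = b3" "b 4 = b4" "b 5 = b5" by (simp_all add: b_def)
  define P where "P i j \<longleftrightarrow> \<mu> (b i) (b j) = lc (\<nu> (axis i 1) (axis j 1))" for i j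
  have lcm: "lc (- v) = - lc v" for v unfolding lc_def by (simp add: algebra_simps)
  have lc0: "lc 0 = 0" unfolding lc_def by simp
  have sym: "P j i" if "P i j" for i j
    unfolding P_def using that[unfolded P_def] acm[of "b j" "b i"] acn[of "axis j 1" "axis i 1"] lcm by metis
  have self: "\<kappa> v v = 0" if "\<And>x y. \<kappa> x y = - \<kappa> y x" for \<kappa> :: "5 alg" and v
    using that[of v v] by (simp add: vec_eq_iff)
  have diag: "P i i" for i unfolding P_def by (simp only: self[of \<mu>, OF acm] self[of \<nu>, OF acn] lc0)
  have up: "P 1 2" "P 1 3" "P 1 4" "P 1 5" "P 2 3" "P 2 4" "P 2 5" "P 3 4" "P 3 5" "P 4 5"
    unfolding P_def b by fact+
  have "\<forall>i j. P i j" unfolding forall_5 using up up[THEN sym] diag by blast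
  then have all: "\<mu> (b i) (b j) = lc (\<nu> (axis i 1) (axis j 1))" for i j unfolding P_def by blast
  have rng: "range b = {b1, b2, b3, b4, b5}" unfolding UNIV_5 by (simp add: b)
  show ?thesis
    by (rule alg_iso_from_basis[OF \<mu> \<nu>, of b]) (use sp in \<open>auto simp: rng all lc_def sum_5 b\<close>)
qed

subsection \<open>Classification\<close>

declare lcs.simps(2) [simp del]

text \<open>A vanishing term of \<open>lcs\<close> is what both uses of the classification can
  provide: nilpotent algebras through \<open>alg_power\<close>, and arbitrary limits of the ten
  through \<open>class_le4\<close>.\<close>

locale lcs_malcev =
  fixes mult :: "5 alg" (infixl "\<cdot>" 70)
  assumes malcev: "malcev mult" and lcs_zero: "\<exists>k. lcs mult k = {0}"
begin

lemma alg: "mult \<in> algebras" using malcev by (simp add: malcev_def)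

lemmas bil = alg_bilinear[OF alg]

lemma ac: "x \<cdot> y = - (y \<cdot> x)" using malcev unfolding malcev_def by blast

lemma self [simp]: "x \<cdot> x = 0"
  using ac[of x x] by (simp add: vec_eq_iff)

abbreviation "L k \<equiv> lcs mult k"

lemma L_diff: "u \<in> L k \<Longrightarrow> v \<in> L k \<Longrightarrow> u - v \<in> L k"
  and L_scale: "u \<in> L k \<Longrightarrow> c *s u \<in> L k"
  and L_neg: "u \<in> L k \<Longrightarrow> - u \<in> L k"
  using vec.subspace_diff[OF subspace_lcs]
    vec.subspace_scale[OF subspace_lcs] vec.subspace_neg[OF subspace_lcs] by blast+

lemma L_mult: "u \<in> L k \<Longrightarrow> x \<cdot> u \<in> L (Suc k)" "u \<in> L k \<Longrightarrow> u \<cdot> x \<in> L (Suc k)"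
  using lcs_mult[of u mult k x] ac[of u x] L_neg[of "x \<cdot> u" "Suc k"] by auto

lemma prod_in_L1: "x \<cdot> y \<in> L 1"
  using L_mult(1)[of y 0 x] by simp

lemma dim_less: "L k \<noteq> {0} \<Longrightarrow> vec.dim (L (Suc k)) < vec.dim (L k)"
  by (rule dim_lcs_Suc_less[OF alg lcs_zero])

lemma dim_L_0: "vec.dim (L k) = 0 \<longleftrightarrow> L k = {0}"
  by (rule subspace_dim_0[OF subspace_lcs])

lemma gens_decomp:
  assumes "vec.span ({x, y, z} \<union> L 1) = UNIV"
  obtains a b c u where "v = a *s x + b *s y + c *s z + u" "u \<in> L 1"
proof -
  have "v \<in> vec.span (insert x (insert y (insert z (L 1))))" using assms by auto
  then obtain a b c where "v - a *s x - b *s y - c *s z \<in> vec.span (L 1)"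
    unfolding vec.span_breakdown_eq by blast
  moreover have "vec.span (L 1) = L 1" using subspace_lcs by (simp only: vec.span_eq_iff)
  ultimately have "v - a *s x - b *s y - c *s z \<in> L 1" by (simp only:)
  then show thesis
    using that[of a b c "v - a *s x - b *s y - c *s z"] by simp
qed

text \<open>Modulo \<open>L 2\<close> the product of two combinations of generators is a combination
  of the three basic products. The products are taken cyclically so that rotating the generators
  preserves the hypotheses, and a repeated generator gives the versions with two generators or
  one.\<close>

lemma L1_subset:
  assumes gens: "vec.span ({x, y, z} \<union> L 1) = UNIV" and S: "vec.subspace S" "L 2 \<subseteq> S"
    and prods: "x \<cdot> y \<in> S" "y \<cdot> z \<in> S" "z \<cdot> x \<in> S"
  shows "L 1 \<subseteq> S"
proof -
  have "v \<cdot> w \<in> S" for v w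
  proof -
    obtain a b c u where v: "v = a *s x + b *s y + c *s z + u" "u \<in> L 1"
      by (rule gens_decomp[OF gens])
    obtain a' b' c' u' where w: "w = a' *s x + b' *s y + c' *s z + u'" "u' \<in> L 1"
      by (rule gens_decomp[OF gens])
    let ?v = "a *s x + b *s y + c *s z" let ?w = "a' *s x + b' *s y + c' *s z"
    have "v \<cdot> w = ?v \<cdot> ?w + ?v \<cdot> u' + u \<cdot> w"
      unfolding v(1) w(1) by (simp add: bil(1,2))
    moreover have "?v \<cdot> ?w = (a * b' - b * a') *s (x \<cdot> y) + (b * c' - c * b') *s (y \<cdot> z)
        + (c * a' - a * c') *s (z \<cdot> x)"
      using ac[of y x] ac[of z y] ac[of x z]
      by (simp add: bil vec_eq_iff algebra_simps)
    moreover have "?v \<cdot> u' \<in> S" "u \<cdot> w \<in> S"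
      using L_mult[OF v(2)] L_mult[OF w(2)] S(2) by (auto simp: numeral_2_eq_2)
    ultimately show ?thesis
      using S(1) prods by (simp add: vec.subspace_add vec.subspace_scale vec.subspace_diff)
  qed
  then show ?thesis unfolding One_nat_def by (intro lcs_Suc_subsetI S(1))
qed

text \<open>The next stage of the same argument: if c spans \<open>L 1\<close> modulo
  \<open>L 2\<close>, then the products of the generators with c span \<open>L 2\<close> modulo
  \<open>L 3\<close>.\<close>

lemma L2_subset:
  assumes gens: "vec.span ({x, y, z} \<union> L 1) = UNIV" and S: "vec.subspace S" "L 3 \<subseteq> S"
    and c: "\<And>u. u \<in> L 1 \<Longrightarrow> \<exists>t. u - t *s c \<in> L 2"
    and prods: "x \<cdot> c \<in> S" "y \<cdot> c \<in> S" "z \<cdot> c \<in> S"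
  shows "L 2 \<subseteq> S"
proof -
  have vc: "v \<cdot> c \<in> S" for v
  proof -
    obtain a b c' u where v: "v = a *s x + b *s y + c' *s z + u" "u \<in> L 1"
      by (rule gens_decomp[OF gens])
    obtain t where t: "u - t *s c \<in> L 2" using c[OF v(2)] by blast
    \<comment> \<open>The multiple of c drops out because c c = 0, which places u c in
      \<open>L 3\<close>.\<close>
    have "u \<cdot> c = (u - t *s c) \<cdot> c" by (simp add: bil)
    then have "u \<cdot> c \<in> S" using L_mult(2)[OF t, of c] S(2) by (auto simp: eval_nat_numeral)
    then show ?thesis
      unfolding v(1) using S(1) prods by (simp add: bil vec.subspace_add vec.subspace_scale)
  qed
  have "v \<cdot> u \<in> S" if u: "u \<in> L 1" for v u
  proof -
    obtain t where t: "u - t *s c \<in> L 2" using c[OF u] by blast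
    have "v \<cdot> u = v \<cdot> (u - t *s c) + t *s (v \<cdot> c)" by (simp add: bil)
    moreover have "v \<cdot> (u - t *s c) \<in> S" using L_mult(1)[OF t, of v] S(2) by (auto simp: eval_nat_numeral)
    ultimately show ?thesis using S(1) vc by (simp add: vec.subspace_add vec.subspace_scale)
  qed
  then show ?thesis unfolding numeral_2_eq_2 by (intro lcs_Suc_subsetI S(1)) simp
qed

lemma UNIV_subset:
  assumes "vec.span (G \<union> L 1) = UNIV" "vec.subspace S" "G \<subseteq> S" "L 1 \<subseteq> S"
  shows "UNIV \<subseteq> S"
  using vec.span_minimal[of "G \<union> L 1" S] assms by simp

lemma multiple_of_nonzero:
  assumes "vec.dim (L k) \<le> 1" "e \<in> L k" "e \<noteq> 0" "v \<in> L k"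
  obtains a where "v = a *s e"
  by (rule subspace_dim_Suc_decomp[of "{0}" "L k" e v])
    (use assms vec.subspace_0[OF subspace_lcs] in \<open>auto simp: subspace_lcs\<close>)


lemma table_ac: "C5 x y = - C5 y x" "n3_C2 x y = - n3_C2 y x" "n4_C x y = - n4_C y x"
  "g51 x y = - g51 y x" "g52 x y = - g52 y x" "g53 x y = - g53 y x" "g54 x y = - g54 y x"
  "g55 x y = - g55 y x" "g56 x y = - g56 y x" "M5 x y = - M5 y x"
  by (simp_all add: coord_simps)

text \<open>The annihilator of q is a subspace containing S, so a nonzero product with q shows p to
  be independent of S.\<close>

lemma not_in_span:
  assumes "\<And>s. s \<in> S \<Longrightarrow> q \<cdot> s = 0" "q \<cdot> p \<noteq> 0" shows "p \<notin> vec.span S"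
proof -
  have "vec.span S \<subseteq> {y. q \<cdot> y = 0}"
    by (rule vec.span_minimal) (use assms(1) subspace_zeros_left[OF alg] in auto)
  then show ?thesis using assms(2) by blast
qed

section \<open>Classification for dim \<open>L 1\<close> at most one\<close>

lemma classify_dim0:
  assumes "vec.dim (L 1) = 0" shows "C5 \<cong>\<^sub>a mult"
proof -
  have "x \<cdot> y = 0" for x y using assms prod_in_L1[of x y] by (simp only: dim_L_0) simp
  then have "mult = C5" by (intro ext) (simp add: coord_simps)
  then show ?thesis by (simp add: alg_iso_refl)
qed

text \<open>The product is an alternating form times a central vector e. A hyperbolic pair x, y
  splits off; on the vectors orthogonal to both, the form is either nonzero, giving a second pair
  and \<open>g51\<close>, or zero, giving \<open>n3_C2\<close>.\<close>

lemma classify_dim1: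
  assumes d: "vec.dim (L 1) = 1" shows "n3_C2 \<cong>\<^sub>a mult \<or> g51 \<cong>\<^sub>a mult"
proof -
  have "L 1 \<noteq> {0}" using d dim_L_0[of 1] by simp
  then have "vec.dim (L 2) = 0" using dim_less[of 1] d by (simp add: eval_nat_numeral)
  then have L2: "L 2 = {0}" by (simp only: dim_L_0)
  have L1mult: "v \<cdot> u = 0" "u \<cdot> v = 0" if "u \<in> L 1" for u v
    using L_mult[OF that, of v] L2 by (simp_all add: eval_nat_numeral)
  obtain x y where xy: "x \<cdot> y \<noteq> 0"
  proof (rule ccontr)
    assume "\<not> thesis"
    then have "L 1 \<subseteq> {0}" unfolding One_nat_def using that by (intro lcs_Suc_subsetI) auto
    then show False using \<open>L 1 \<noteq> {0}\<close> vec.subspace_0[OF subspace_lcs, of mult 1] by blast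
  qed
  define e where "e = x \<cdot> y"
  have e: "v \<cdot> e = 0" "e \<cdot> v = 0" for v unfolding e_def by (rule L1mult[OF prod_in_L1])+
  have yx: "y \<cdot> x = - e" unfolding e_def by (rule ac)
  have e0: "e \<noteq> 0" using xy by (simp add: e_def)
  have mul: "\<exists>a. v \<cdot> w = a *s e" for v w
    using multiple_of_nonzero[of 1 e "v \<cdot> w"] d e0 prod_in_L1 unfolding e_def by (metis order_refl)
  \<comment> \<open>Projection to the orthogonal complement of the pair: from x y = e and y x = -e,
    the multiple of y corrects the product with x, and the multiple of x the product with y.\<close>
  have corr: "\<exists>a b. x \<cdot> (v - a *s y + b *s x) = 0 \<and> y \<cdot> (v - a *s y + b *s x) = 0" for v
  proof -
    obtain a b where "x \<cdot> v = a *s e" "y \<cdot> v = b *s e" using mul by blast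
    then have "x \<cdot> (v - a *s y + b *s x) = 0 \<and> y \<cdot> (v - a *s y + b *s x) = 0"
      by (simp add: bil e_def[symmetric] yx)
    then show ?thesis by blast
  qed
  have x_notin: "x \<notin> vec.span S" if "\<And>s. s \<in> S \<Longrightarrow> y \<cdot> s = 0" for S
    by (rule not_in_span[of S y]) (use that e0 yx in auto)
  have y_notin: "y \<notin> vec.span S" if "\<And>s. s \<in> S \<Longrightarrow> x \<cdot> s = 0" for S
    by (rule not_in_span[of S x]) (use that xy in auto)
  show ?thesis
  proof (cases "\<exists>u v. x \<cdot> u = 0 \<and> y \<cdot> u = 0 \<and> x \<cdot> v = 0 \<and> y \<cdot> v = 0 \<and> u \<cdot> v \<noteq> 0")
    case True
    then obtain u0 v where uv0: "x \<cdot> u0 = 0" "y \<cdot> u0 = 0" "x \<cdot> v = 0" "y \<cdot> v = 0" "u0 \<cdot> v \<noteq> 0" by blast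
    obtain r where r: "u0 \<cdot> v = r *s e" using mul by blast
    then have "r \<noteq> 0" using uv0(5) by auto
    define u where "u = (1 / r) *s u0"
    have uv: "x \<cdot> u = 0" "y \<cdot> u = 0" "x \<cdot> v = 0" "y \<cdot> v = 0" "u \<cdot> v = e"
      using uv0 r \<open>r \<noteq> 0\<close> by (simp_all add: u_def bil)
    have vu: "v \<cdot> u = - e" using ac[of v u] uv(5) by simp
    \<comment> \<open>Beyond e, each new vector is separated from the earlier ones by multiplication
      with its partner in the form.\<close>
    have "e \<notin> vec.span {}" using e0 by simp
    moreover have "u \<notin> vec.span {e}" by (rule not_in_span[of _ v]) (use e vu e0 in auto)
    moreover have "v \<notin> vec.span {u, e}" by (rule not_in_span[of _ u]) (use e uv e0 in auto)
    moreover have "y \<notin> vec.span {v, u, e}" by (rule y_notin) (use e uv in auto)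
    moreover have "x \<notin> vec.span {y, v, u, e}" by (rule x_notin) (use e uv in auto)
    ultimately have "vec.dim {x, y, v, u, e} = 5" by (simp add: vec.dim_insert)
    moreover have "{x, y, u, v, e} = {x, y, v, u, e}" by blast
    ultimately have sp: "vec.span {x, y, u, v, e} = UNIV" by (simp add: span_eq_UNIV_iff_dim)
    have "g51 \<cong>\<^sub>a mult"
      by (rule alg_iso_basis5[OF alg table_in_algebras(4) ac table_ac(4), of x y u v e])
        (use sp in \<open>simp_all add: coord_simps uv e e_def[symmetric]\<close>)
    then show ?thesis ..
  next
    case False
    have d3: "3 \<le> vec.dim {x, y, e}"
    proof -
      have "e \<notin> vec.span {}" using e0 by simp
      moreover have "y \<notin> vec.span {e}" by (rule y_notin) (use e in auto)
      moreover have "x \<notin> vec.span {y, e}" by (rule x_notin) (use e in auto)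
      ultimately show ?thesis by (simp add: vec.dim_insert)
    qed
    obtain u0 v0 where uv0: "vec.span ({u0, v0} \<union> {x, y, e}) = UNIV"
      using extend_span5(2)[OF d3] by blast
    obtain a b where u: "x \<cdot> (u0 - a *s y + b *s x) = 0" "y \<cdot> (u0 - a *s y + b *s x) = 0"
      using corr by blast
    obtain a' b' where v: "x \<cdot> (v0 - a' *s y + b' *s x) = 0" "y \<cdot> (v0 - a' *s y + b' *s x) = 0"
      using corr by blast
    define u where "u = u0 - a *s y + b *s x"
    define v where "v = v0 - a' *s y + b' *s x"
    have uv: "x \<cdot> u = 0" "y \<cdot> u = 0" "x \<cdot> v = 0" "y \<cdot> v = 0" using u v unfolding u_def v_def by blast+
    then have uv': "u \<cdot> v = 0" using False by blast
    let ?S = "vec.span {x, y, e, u, v}"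
    have S: "x \<in> ?S" "y \<in> ?S" "e \<in> ?S" "u \<in> ?S" "v \<in> ?S" by (auto intro: vec.span_base)
    have "u0 = u + a *s y - b *s x" "v0 = v + a' *s y - b' *s x" by (simp_all add: u_def v_def)
    then have "u0 \<in> ?S" "v0 \<in> ?S"
      using S by (simp_all only: vec.span_add vec.span_diff vec.span_scale)
    then have sp: "UNIV \<subseteq> ?S"
      unfolding uv0[symmetric] using S by (intro vec.span_minimal) (auto simp: vec.subspace_span)
    have "n3_C2 \<cong>\<^sub>a mult"
      by (rule alg_iso_basis5[OF alg table_in_algebras(2) ac table_ac(2), of x y e u v])
        (use sp in \<open>simp_all add: coord_simps uv uv' e e_def[symmetric]\<close>)
    then show ?thesis ..
  qed
qed

section \<open>Classification for dim \<open>L 1\<close> = 2: three generators\<close>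

text \<open>The relation y z = p (z x) + q (x y) is absorbed by shifting y and z by multiples of x,
  since (y + p x)(z + q x) = y z - p (z x) - q (x y). Then x alone produces all products.\<close>

lemma classify_class2:
  assumes gens: "vec.span ({x, y, z} \<union> L 1) = UNIV" and L2: "L 2 = {0}"
    and rel: "y \<cdot> z \<in> vec.span {z \<cdot> x, x \<cdot> y}"
  shows "g52 \<cong>\<^sub>a mult"
proof -
  obtain p q where "y \<cdot> z - p *s (z \<cdot> x) - q *s (x \<cdot> y) = 0"
    using rel by (auto simp: vec.span_breakdown_eq)
  then have pq: "y \<cdot> z = p *s (z \<cdot> x) + q *s (x \<cdot> y)" by (simp add: algebra_simps)
  define y' z' where "y' = y + p *s x" and "z' = z + q *s x"
  have "y' \<cdot> z' = 0"
    using ac[of y x] ac[of x z] by (simp add: y'_def z'_def bil pq)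
  then have zy: "y' \<cdot> z' = 0" "z' \<cdot> y' = 0" using ac[of z' y'] by simp_all
  have L1mult: "v \<cdot> u = 0" "u \<cdot> v = 0" if "u \<in> L 1" for u v
    using L_mult[OF that, of v] L2 by (simp_all add: eval_nat_numeral)
  define b4 b5 where "b4 = x \<cdot> y'" and "b5 = x \<cdot> z'"
  have b45: "v \<cdot> b4 = 0" "b4 \<cdot> v = 0" "v \<cdot> b5 = 0" "b5 \<cdot> v = 0" for v
    unfolding b4_def b5_def by (rule L1mult[OF prod_in_L1])+
  let ?S = "vec.span {x, y', z', b4, b5}"
  have S: "x \<in> ?S" "y' \<in> ?S" "z' \<in> ?S" "b4 \<in> ?S" "b5 \<in> ?S" by (auto intro: vec.span_base)
  have "y = y' - p *s x" "z = z' - q *s x" by (simp_all add: y'_def z'_def)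
  then have yz: "y \<in> ?S" "z \<in> ?S" using S by (simp_all only: vec.span_diff vec.span_scale)
  have "x \<cdot> y = b4" "z \<cdot> x = - b5"
    using ac[of z x] by (simp_all add: b4_def b5_def y'_def z'_def bil)
  then have pr: "x \<cdot> y \<in> ?S" "z \<cdot> x \<in> ?S" using S by (simp_all add: vec.span_neg)
  then have "y \<cdot> z \<in> ?S" unfolding pq by (intro vec.span_add vec.span_scale)
  then have "L 1 \<subseteq> ?S"
    using pr L2 by (intro L1_subset[OF gens]) (auto simp: vec.span_zero)
  then have sp: "UNIV \<subseteq> ?S"
    using S yz by (intro UNIV_subset[OF gens]) auto
  show ?thesis
    by (rule alg_iso_basis5[OF alg table_in_algebras(5) ac table_ac(5), of x y' z' b4 b5])
      (use sp in \<open>simp_all add: coord_simps b45 zy b4_def[symmetric] b5_def[symmetric]\<close>)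
qed

text \<open>With c = x y and e = x c spanning \<open>L 2\<close>, shifting y by x gives y' c = 0 and
  shifting k by c gives x k' = 0. The one product left open is y' k' = \<beta> e: zero for
  \<open>n4_C\<close>, nonzero for \<open>g53\<close>.\<close>

lemma classify_class3_aux:
  assumes gens: "vec.span ({x, y, k} \<union> L 1) = UNIV" and L3: "L 3 = {0}" and d2: "vec.dim (L 2) = 1"
    and c: "\<And>u. u \<in> L 1 \<Longrightarrow> \<exists>t. u - t *s (x \<cdot> y) \<in> L 2"
    and xk: "x \<cdot> k \<in> L 2" and yk: "y \<cdot> k \<in> L 2"
    and kc: "k \<cdot> (x \<cdot> y) = 0" and xc: "x \<cdot> (x \<cdot> y) \<noteq> 0"
  shows "n4_C \<cong>\<^sub>a mult \<or> g53 \<cong>\<^sub>a mult"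
proof -
  have L2mult: "v \<cdot> u = 0" "u \<cdot> v = 0" if "u \<in> L 2" for u v
    using L_mult[OF that, of v] L3 by (simp_all add: eval_nat_numeral)
  define c where "c = x \<cdot> y"
  define e where "e = x \<cdot> c"
  have cL2: "v \<cdot> c \<in> L 2" for v
    unfolding c_def using L_mult(1)[OF prod_in_L1] by (simp add: eval_nat_numeral)
  have e0: "e \<noteq> 0" using xc by (simp add: e_def c_def)
  have mul: "\<exists>a. u = a *s e" if "u \<in> L 2" for u
    using multiple_of_nonzero[of 2 e u] d2 e0 that cL2 unfolding e_def by (metis order_refl)
  have ee: "v \<cdot> e = 0" "e \<cdot> v = 0" for v unfolding e_def by (rule L2mult[OF cL2])+
  obtain q where q: "y \<cdot> c = q *s e" using mul[OF cL2] by blast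
  define y' where "y' = y - q *s x"
  have xy': "x \<cdot> y' = c" by (simp add: y'_def c_def bil)
  have y'c: "y' \<cdot> c = 0" by (simp add: y'_def bil q e_def[symmetric])
  obtain \<alpha> where \<alpha>: "x \<cdot> k = \<alpha> *s e" using mul[OF xk] by blast
  define k' where "k' = k - \<alpha> *s c"
  have xk': "x \<cdot> k' = 0" by (simp add: k'_def bil \<alpha> e_def[symmetric])
  have k'c: "k' \<cdot> c = 0" using kc by (simp add: k'_def bil c_def[symmetric])
  have "y' \<cdot> k \<in> L 2" unfolding y'_def by (simp only: bil L_diff L_scale xk yk)
  then obtain \<beta> where "y' \<cdot> k = \<beta> *s e" using mul by blast
  then have \<beta>: "y' \<cdot> k' = \<beta> *s e" by (simp add: k'_def bil y'c)
  have ck': "c \<cdot> k' = 0" "c \<cdot> y' = 0" "y' \<cdot> x = - c" using ac[of c k'] k'c ac[of c y'] y'c ac[of y' x] xy' by simp_all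
  have sp: "UNIV \<subseteq> S" if S: "vec.subspace S" "x \<in> S" "y' \<in> S" "c \<in> S" "e \<in> S" "k' \<in> S" for S
  proof -
    have "y = y' + q *s x" "k = k' + \<alpha> *s c" by (simp_all add: y'_def k'_def)
    then have "y \<in> S" "k \<in> S"
      using S by (simp_all add: vec.subspace_add vec.subspace_scale)
    have L2: "L 2 \<subseteq> S" using mul S by (metis subsetI vec.subspace_scale)
    have "L 1 \<subseteq> S"
    proof
      fix u assume "u \<in> L 1"
      then obtain t where "u - t *s c \<in> L 2" using assms(4) unfolding c_def by blast
      then have "(u - t *s c) + t *s c \<in> S" using L2 S by (intro vec.subspace_add vec.subspace_scale) auto
      then show "u \<in> S" by simp
    qed
    then show ?thesis using S \<open>y \<in> S\<close> \<open>k \<in> S\<close> by (intro UNIV_subset[OF gens]) auto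
  qed
  show ?thesis
  proof (cases "\<beta> = 0")
    case True
    have "UNIV \<subseteq> vec.span {x, y', c, e, k'}"
      by (rule sp) (auto intro: vec.span_base simp: vec.subspace_span)
    then have "n4_C \<cong>\<^sub>a mult"
      by (intro alg_iso_basis5[OF alg table_in_algebras(3) ac table_ac(3), of x y' c e k'])
        (simp_all add: coord_simps ee xy' y'c xk' ck' \<beta> True e_def[symmetric])
    then show ?thesis ..
  next
    case False
    \<comment> \<open>In \<open>g53\<close> it is e2 whose product with e3 is nonzero, so x takes
      the second place and y' the first. The signs follow from y' x = -c, and the factor makes y'
      times the fourth vector equal to -e.\<close>
    let ?b4 = "(- 1 / \<beta>) *s k'"
    let ?S = "vec.span {y', x, - c, ?b4, - e}"
    have b: "x \<in> ?S" "y' \<in> ?S" "- c \<in> ?S" "- e \<in> ?S" "?b4 \<in> ?S" by (auto intro: vec.span_base)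
    have "k' = (- \<beta>) *s ?b4" using False by simp
    then have "k' \<in> ?S" using b(5) vec.span_scale by metis
    moreover have "c \<in> ?S" "e \<in> ?S" using b(3,4) vec.span_neg by fastforce+
    ultimately have "UNIV \<subseteq> ?S" using b by (intro sp vec.subspace_span)
    then have "g53 \<cong>\<^sub>a mult"
      using False by (intro alg_iso_basis5[OF alg table_in_algebras(6) ac table_ac(6), of y' x "- c" ?b4 "- e"])
        (simp_all add: coord_simps bil ee xy' y'c xk' ck' \<beta> e_def[symmetric] vector_sneg_minus1[symmetric])
    then show ?thesis ..
  qed
qed

text \<open>The third generator is corrected to k with x k and y k in \<open>L 2\<close>. If k
  annihilates c = x y, then x or y does not, and the auxiliary lemma applies to one of the two
  orders of x, y. If k c is nonzero, it spans \<open>L 2\<close> and the algebra is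
  \<open>M5\<close>.\<close>

lemma classify_class3:
  assumes gens0: "vec.span ({x, y, z} \<union> L 1) = UNIV" and L3: "L 3 = {0}"
    and d1: "vec.dim (L 1) = 2" and d2: "vec.dim (L 2) = 1" and xy: "x \<cdot> y \<notin> L 2"
  shows "n4_C \<cong>\<^sub>a mult \<or> g53 \<cong>\<^sub>a mult \<or> M5 \<cong>\<^sub>a mult"
proof -
  have L2mult: "v \<cdot> u = 0" "u \<cdot> v = 0" if "u \<in> L 2" for u v
    using L_mult[OF that, of v] L3 by (simp_all add: eval_nat_numeral)
  define c where "c = x \<cdot> y"
  have dec: "\<exists>t. u - t *s c \<in> L 2" if "u \<in> L 1" for u
    by (rule subspace_dim_Suc_decomp[of "L 2" "L 1" c u])
      (use that d1 d2 xy prod_in_L1[of x y] lcs_Suc_subset[of mult 1] in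
        \<open>auto simp: subspace_lcs c_def eval_nat_numeral\<close>)
  obtain a b where ab: "x \<cdot> z - a *s c \<in> L 2" "y \<cdot> z - b *s c \<in> L 2"
    using dec[OF prod_in_L1] by blast
  \<comment> \<open>Modulo \<open>L 2\<close> one has x z = a c, y z = b c and y x = -c, so the two
    corrections cancel both products.\<close>
  define k where "k = z - a *s y + b *s x"
  have "x \<cdot> k = x \<cdot> z - a *s c" "y \<cdot> k = y \<cdot> z - b *s c"
    using ac[of y x] by (simp_all add: k_def bil c_def)
  then have xk: "x \<cdot> k \<in> L 2" and yk: "y \<cdot> k \<in> L 2" using ab by simp_all
  have gens: "vec.span ({x, y, k} \<union> L 1) = UNIV"
  proof -
    let ?S = "vec.span ({x, y, k} \<union> L 1)"
    have m: "x \<in> ?S" "y \<in> ?S" "k \<in> ?S" "L 1 \<subseteq> ?S" by (auto intro: vec.span_base)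
    have "z = k + a *s y - b *s x" by (simp add: k_def)
    then have "z \<in> ?S" using m by (simp only: vec.span_add vec.span_diff vec.span_scale)
    then show ?thesis using m UNIV_subset[OF gens0 vec.subspace_span, of "{x, y, k} \<union> L 1"] by auto
  qed
  have gens': "vec.span ({y, x, k} \<union> L 1) = UNIV" using gens by (simp add: insert_commute)
  have cL2: "v \<cdot> c \<in> L 2" for v
    unfolding c_def using L_mult(1)[OF prod_in_L1] by (simp add: eval_nat_numeral)
  show ?thesis
  proof (cases "k \<cdot> c = 0")
    case True
    have "x \<cdot> c \<noteq> 0 \<or> y \<cdot> c \<noteq> 0"
    proof (rule ccontr)
      assume "\<not> ?thesis"
      then have "L 2 \<subseteq> {0}"
        using True L3 dec by (intro L2_subset[OF gens, of _ c]) auto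
      then show False using d2 vec.dim_eq_0[of "L 2"] by simp
    qed
    moreover have yx: "y \<cdot> x = - c" unfolding c_def by (rule ac)
    have dec': "\<exists>t. u - t *s (y \<cdot> x) \<in> L 2" if u: "u \<in> L 1" for u
    proof -
      obtain t where "u - t *s c \<in> L 2" using dec[OF u] by blast
      then have "u - (- t) *s (y \<cdot> x) \<in> L 2" by (simp add: yx)
      then show ?thesis by blast
    qed
    ultimately show ?thesis
      using classify_class3_aux[OF gens L3 d2 _ xk yk] classify_class3_aux[OF gens' L3 d2 dec' yk xk]
        True dec yx by (fastforce simp: bil c_def[symmetric])
  next
    case False
    define e where "e = k \<cdot> c"
    have mul: "\<exists>a. u = a *s e" if "u \<in> L 2" for u
      using multiple_of_nonzero[of 2 e u] d2 False that cL2 unfolding e_def by (metis order_refl)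
    have ee: "v \<cdot> e = 0" "e \<cdot> v = 0" for v unfolding e_def by (rule L2mult[OF cL2])+
    obtain p q where p: "x \<cdot> c = p *s e" and q: "y \<cdot> c = q *s e" using mul[OF cL2] by blast
    \<comment> \<open>Multiples of k are removed so that x' and y' annihilate c. Their product c'
      changes only by an element l of \<open>L 2\<close>, which annihilates everything, so products
      with c and with c' agree.\<close>
    define x' y' where "x' = x - p *s k" and "y' = y - q *s k"
    define c' where "c' = x' \<cdot> y'"
    have "c' = c - (q *s (x \<cdot> k) - p *s (y \<cdot> k))"
      using ac[of k y] by (simp add: c'_def x'_def y'_def bil c_def)
    moreover define l where "l = q *s (x \<cdot> k) - p *s (y \<cdot> k)"
    ultimately have c': "c' = c - l" by simp
    have l: "l \<in> L 2" unfolding l_def by (intro L_diff L_scale xk yk)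
    have vc': "v \<cdot> c' = v \<cdot> c" for v by (simp add: c' bil L2mult[OF l])
    have x'c: "x' \<cdot> c' = 0" "y' \<cdot> c' = 0" "k \<cdot> c' = e"
      unfolding vc' by (simp_all add: x'_def y'_def bil p q e_def[symmetric])
    have cx': "c' \<cdot> x' = 0" "c' \<cdot> y' = 0" "c' \<cdot> k = - e"
      using ac[of c' x'] ac[of c' y'] ac[of c' k] x'c by simp_all
    have "k \<cdot> x' \<in> L 2" "k \<cdot> y' \<in> L 2"
      using ac[of k x] ac[of k y] by (simp_all add: x'_def y'_def bil L_neg xk yk)
    then obtain \<alpha> \<beta> where \<alpha>: "k \<cdot> x' = \<alpha> *s e" and \<beta>: "k \<cdot> y' = \<beta> *s e" using mul by metis
    \<comment> \<open>Since k c' = e, subtracting multiples of c' removes the remaining products of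
      k with x' and y' without disturbing the others.\<close>
    define x'' y'' where "x'' = x' - \<alpha> *s c'" and "y'' = y' - \<beta> *s c'"
    have k: "k \<cdot> x'' = 0" "k \<cdot> y'' = 0" by (simp_all add: x''_def y''_def bil \<alpha> \<beta> x'c)
    then have k': "x'' \<cdot> k = 0" "y'' \<cdot> k = 0" using ac[of x'' k] ac[of y'' k] by simp_all
    have prods: "x'' \<cdot> y'' = c'" "x'' \<cdot> c' = 0" "y'' \<cdot> c' = 0"
      by (simp_all add: x''_def y''_def bil x'c cx' c'_def[symmetric])
    let ?S = "vec.span {x'', y'', k, c', e}"
    have S: "x'' \<in> ?S" "y'' \<in> ?S" "k \<in> ?S" "c' \<in> ?S" "e \<in> ?S" by (auto intro: vec.span_base)
    have L2: "L 2 \<subseteq> ?S" using mul S(5) by (metis subsetI vec.span_scale)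
    have "c' + l \<in> ?S" using S(4) L2 l by (intro vec.span_add) auto
    then have cS: "c \<in> ?S" by (simp add: c')
    have L1: "L 1 \<subseteq> ?S"
    proof
      fix u assume "u \<in> L 1"
      then obtain t where "u - t *s c \<in> L 2" using dec by blast
      then have "(u - t *s c) + t *s c \<in> ?S" using L2 cS by (intro vec.span_add vec.span_scale) auto
      then show "u \<in> ?S" by simp
    qed
    have "x = x'' + \<alpha> *s c' + p *s k" "y = y'' + \<beta> *s c' + q *s k"
      by (simp_all add: x''_def y''_def x'_def y'_def)
    then have "x \<in> ?S" "y \<in> ?S" using S by (simp_all only: vec.span_add vec.span_scale)
    then have sp: "UNIV \<subseteq> ?S" using S L1 by (intro UNIV_subset[OF gens vec.subspace_span]) simp_all
    have "M5 \<cong>\<^sub>a mult"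
      by (rule alg_iso_basis5[OF alg table_in_algebras(10) ac table_ac(10), of x'' y'' k c' e])
        (use sp in \<open>simp_all add: coord_simps prods k' x'c(3) ee\<close>)
    then show ?thesis by blast
  qed
qed

text \<open>If \<open>L 2\<close> vanishes, three products in a plane are dependent; otherwise some
  product lies outside \<open>L 2\<close>. A cyclic rotation of the generators moves the
  distinguished product to the place that the previous lemmas expect.\<close>

lemma classify_dim2:
  assumes d1: "vec.dim (L 1) = 2"
  shows "g52 \<cong>\<^sub>a mult \<or> n4_C \<cong>\<^sub>a mult \<or> g53 \<cong>\<^sub>a mult \<or> M5 \<cong>\<^sub>a mult"
proof -
  obtain x y z where gens: "vec.span ({x, y, z} \<union> L 1) = UNIV"
    using extend_span5(3)[of "L 1"] d1 by auto
  then have gens': "vec.span ({y, z, x} \<union> L 1) = UNIV" "vec.span ({z, x, y} \<union> L 1) = UNIV"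
    by (simp_all add: insert_commute)
  have "L 1 \<noteq> {0}" using d1 dim_L_0[of 1] by auto
  then have less: "vec.dim (L 2) < 2" using dim_less[of 1] d1 by (simp add: eval_nat_numeral)
  show ?thesis
  proof (cases "L 2 = {0}")
    case True
    \<comment> \<open>Dependence read along the chain of independent insertions: the first vector
      that fails to enlarge the span is a combination of those already inserted.\<close>
    have "x \<cdot> y = 0 \<or> z \<cdot> x \<in> vec.span {x \<cdot> y} \<or> y \<cdot> z \<in> vec.span {z \<cdot> x, x \<cdot> y}"
    proof (rule ccontr)
      assume "\<not> ?thesis"
      then have "vec.dim {y \<cdot> z, z \<cdot> x, x \<cdot> y} = 3" by (simp add: vec.dim_insert)
      moreover have "vec.dim {y \<cdot> z, z \<cdot> x, x \<cdot> y} \<le> vec.dim (L 1)"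
        using prod_in_L1 by (intro vec.dim_subset) auto
      ultimately show False using d1 by simp
    qed
    then have "x \<cdot> y \<in> vec.span {y \<cdot> z, z \<cdot> x} \<or> z \<cdot> x \<in> vec.span {x \<cdot> y, y \<cdot> z} \<or> y \<cdot> z \<in> vec.span {z \<cdot> x, x \<cdot> y}"
      using vec.span_mono[of "{x \<cdot> y}" "{x \<cdot> y, y \<cdot> z}"] by (auto simp: vec.span_zero)
    then have "g52 \<cong>\<^sub>a mult"
      using classify_class2[OF gens True] classify_class2[OF gens'(1) True] classify_class2[OF gens'(2) True]
      by blast
    then show ?thesis ..
  next
    case False
    then have d2: "vec.dim (L 2) = 1" using less dim_L_0[of 2] by linarith
    then have "vec.dim (L 3) = 0" using dim_less[OF False] by (simp add: eval_nat_numeral)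
    then have L3: "L 3 = {0}" by (simp only: dim_L_0)
    have "\<not> L 1 \<subseteq> L 2" using vec.dim_subset[of "L 1" "L 2"] d1 d2 by auto
    then have "x \<cdot> y \<notin> L 2 \<or> y \<cdot> z \<notin> L 2 \<or> z \<cdot> x \<notin> L 2"
      using L1_subset[OF gens subspace_lcs order_refl] by blast
    then show ?thesis
      using classify_class3[OF gens L3 d1 d2] classify_class3[OF gens'(1) L3 d1 d2]
        classify_class3[OF gens'(2) L3 d1 d2] by blast
  qed
qed


section \<open>Classification for dim \<open>L 1\<close> = 3: two generators\<close>

context
  fixes x y assumes gens: "vec.span ({x, y} \<union> L 1) = UNIV"
begin

lemma two_gens_L1: "L 1 \<subseteq> vec.span (insert (x \<cdot> y) (L 2))"
proof (rule L1_subset[of x y y])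
  have "x \<cdot> y \<in> vec.span (insert (x \<cdot> y) (L 2))" by (simp add: vec.span_base)
  then show "x \<cdot> y \<in> vec.span (insert (x \<cdot> y) (L 2))" "y \<cdot> x \<in> vec.span (insert (x \<cdot> y) (L 2))"
    using ac[of y x] vec.span_neg by simp_all
qed (use gens in \<open>auto intro: vec.span_base simp: vec.subspace_span vec.span_zero\<close>)

lemma two_gens_decomp: "u \<in> L 1 \<Longrightarrow> \<exists>t. u - t *s (x \<cdot> y) \<in> L 2"
proof -
  assume "u \<in> L 1"
  then have "u \<in> vec.span (insert (x \<cdot> y) (L 2))" using two_gens_L1 by blast
  moreover have "vec.span (L 2) = L 2" using subspace_lcs by (simp only: vec.span_eq_iff)
  ultimately show ?thesis by (simp only: vec.span_breakdown_eq)
qed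

lemma two_gens_L2:
  assumes "vec.subspace S" "L 3 \<subseteq> S" "x \<cdot> (x \<cdot> y) \<in> S" "y \<cdot> (x \<cdot> y) \<in> S"
  shows "L 2 \<subseteq> S"
  by (rule L2_subset[of x y y S "x \<cdot> y"]) (use gens assms two_gens_decomp in auto)

end

text \<open>The chain c = x y, d = x c, e = x d spans \<open>L 1\<close>. Once y d and c d vanish,
  the only parameter is \<gamma> in y c = \<gamma> e, and rescaling reduces it to 0 or 1.\<close>

lemma classify_class4:
  assumes gens: "vec.span ({x, y} \<union> L 1) = UNIV" and L4: "L 4 = {0}"
    and yc: "y \<cdot> (x \<cdot> y) \<in> L 3"
  shows "g55 \<cong>\<^sub>a mult \<or> g56 \<cong>\<^sub>a mult"
proof -
  have L3mult: "v \<cdot> u = 0" "u \<cdot> v = 0" if "u \<in> L 3" for u v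
    using L_mult[OF that, of v] L4 by (simp_all add: eval_nat_numeral)
  define c where "c = x \<cdot> y"
  define d where "d = x \<cdot> c"
  define e where "e = x \<cdot> d"
  have yx: "y \<cdot> x = - c" unfolding c_def by (rule ac)
  have cx: "c \<cdot> x = - d" unfolding d_def by (rule ac)
  have dx: "d \<cdot> x = - e" unfolding e_def by (rule ac)
  have cL: "c \<in> L 1" unfolding c_def by (rule prod_in_L1)
  have dL: "d \<in> L 2" unfolding d_def using L_mult(1)[OF cL] by (simp add: eval_nat_numeral)
  have eL: "e \<in> L 3" unfolding e_def using L_mult(1)[OF dL] by (simp add: eval_nat_numeral)
  have ycL: "y \<cdot> c \<in> L 3" using yc by (simp add: c_def)
  \<comment> \<open>The only use of the Malcev identity in the classification: it forces \<open>y d = 0\<close> and \<open>c d = 0\<close>.\<close>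
  have J: "jacobian mult a b (a \<cdot> z) = jacobian mult a b z \<cdot> a" for a b z
    using malcev unfolding malcev_def by blast
  have Jc: "jacobian mult x y c = y \<cdot> d"
    unfolding jacobian_def using ac[of d y] by (simp add: c_def[symmetric] L3mult[OF ycL] cx bil)
  have "jacobian mult x y y = 0"
    unfolding jacobian_def by (simp add: c_def[symmetric] yx bil)
  \<comment> \<open>The Malcev identity with third entry y gives y d = 0, since the Jacobian of x,
    y, y vanishes. With third entry c it makes the Jacobian of x, y, d vanish, and there c d is the
    only term left.\<close>
  then have yd: "y \<cdot> d = 0" using J[of x y y] Jc by (simp add: c_def[symmetric] bil)
  have "jacobian mult x y d = 0" using J[of x y c] Jc yd by (simp add: d_def[symmetric] bil)
  then have cd: "c \<cdot> d = 0"
    unfolding jacobian_def using L3mult[OF eL] by (simp add: c_def[symmetric] yd dx bil)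
  have L2: "\<exists>t. u - t *s d \<in> L 3" if "u \<in> L 2" for u
  proof -
    have "L 2 \<subseteq> vec.span (insert d (L 3))"
      by (rule two_gens_L2[OF gens])
        (use ycL in \<open>auto intro: vec.span_base simp: vec.subspace_span d_def c_def\<close>)
    then have "u \<in> vec.span (insert d (L 3))" using that by blast
    moreover have "vec.span (L 3) = L 3" using subspace_lcs by (simp only: vec.span_eq_iff)
    ultimately show ?thesis by (simp only: vec.span_breakdown_eq)
  qed
  have L2d: "u \<cdot> d = 0" if "u \<in> L 2" for u
  proof -
    obtain t where "u - t *s d \<in> L 3" using L2[OF \<open>u \<in> L 2\<close>] by blast
    from L3mult(2)[OF this, of d] show ?thesis by (simp add: bil)
  qed
  have L1d: "u \<cdot> d = 0" if "u \<in> L 1" for u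
  proof -
    obtain t where "u - t *s c \<in> L 2" using two_gens_decomp[OF gens \<open>u \<in> L 1\<close>] unfolding c_def by blast
    from L2d[OF this] show ?thesis by (simp add: bil cd)
  qed
  have gens3: "vec.span ({x, y, y} \<union> L 1) = UNIV" using gens by simp
  have vd: "v \<cdot> d \<in> vec.span {e}" for v
  proof -
    obtain a b b' u where v: "v = a *s x + b *s y + b' *s y + u" "u \<in> L 1" by (rule gens_decomp[OF gens3])
    have "v \<cdot> d = a *s e" unfolding v(1) by (simp add: bil yd L1d[OF v(2)] e_def)
    then show ?thesis by (simp add: vec.span_base vec.span_scale)
  qed
  have L3: "L 3 \<subseteq> vec.span {e}"
    unfolding numeral_3_eq_3
  proof (rule lcs_Suc_subsetI)
    fix v u assume "u \<in> L (Suc (Suc 0))"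
    then obtain t where t: "u - t *s d \<in> L 3" using L2[of u] by (auto simp: numeral_2_eq_2)
    have "v \<cdot> u = t *s (v \<cdot> d)" using L3mult(1)[OF t, of v] by (simp add: bil)
    then show "v \<cdot> u \<in> vec.span {e}" by (simp only: vec.span_scale[OF vd])
  qed (rule vec.subspace_span)
  obtain \<gamma> where \<gamma>: "y \<cdot> c = \<gamma> *s e" using ycL L3 by (auto simp: vec.span_singleton)
  have sp: "UNIV \<subseteq> S" if S: "vec.subspace S" "x \<in> S" "y \<in> S" "c \<in> S" "d \<in> S" "e \<in> S" for S
  proof -
    have e: "vec.span {e} \<subseteq> S" using S by (intro vec.span_minimal) auto
    then have "L 2 \<subseteq> S"
      using S L3 ycL by (intro two_gens_L2[OF gens]) (auto simp: c_def d_def)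
    then have "L 1 \<subseteq> S"
      using S two_gens_L1[OF gens] vec.span_minimal[of "insert (x \<cdot> y) (L 2)" S] by (auto simp: c_def)
    then show ?thesis using S by (intro UNIV_subset[OF gens]) auto
  qed
  show ?thesis
  proof (cases "\<gamma> = 0")
    case True
    have "UNIV \<subseteq> vec.span {x, y, c, d, e}"
      by (rule sp) (auto intro: vec.span_base simp: vec.subspace_span)
    then have "g55 \<cong>\<^sub>a mult"
      by (intro alg_iso_basis5[OF alg table_in_algebras(8) ac table_ac(8), of x y c d e])
        (simp_all add: coord_simps \<gamma> True yd cd L3mult[OF eL] c_def[symmetric] d_def[symmetric] e_def[symmetric])
    then show ?thesis ..
  next
    case False
    \<comment> \<open>Scaling y by r scales c, d and e by r, whereas y c scales by r^2; hence r
      \<gamma> = 1 turns the coefficient into 1.\<close>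
    let ?r = "1 / \<gamma>"
    let ?S = "vec.span {x, ?r *s y, ?r *s c, ?r *s d, ?r *s e}"
    have r: "v \<in> ?S" if "?r *s v \<in> ?S" for v
      using vec.span_scale[OF that, of \<gamma>] False by simp
    have "UNIV \<subseteq> ?S"
      by (rule sp) (auto intro: vec.span_base r simp: vec.subspace_span)
    then have "g56 \<cong>\<^sub>a mult"
      using False by (intro alg_iso_basis5[OF alg table_in_algebras(9) ac table_ac(9),
            of x "?r *s y" "?r *s c" "?r *s d" "?r *s e"])
        (simp_all add: coord_simps bil \<gamma> yd cd L3mult[OF eL] c_def[symmetric] d_def[symmetric] e_def[symmetric])
    then show ?thesis ..
  qed
qed

text \<open>Two generators have one product up to sign, so \<open>L 1\<close> exceeds
  \<open>L 2\<close> by one dimension and dim \<open>L 2\<close> = 2. Then \<open>L 3\<close> is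
  zero for \<open>g54\<close> and a line for \<open>g55\<close> and \<open>g56\<close>.\<close>

lemma classify_dim3:
  assumes d1: "vec.dim (L 1) = 3"
  shows "g54 \<cong>\<^sub>a mult \<or> g55 \<cong>\<^sub>a mult \<or> g56 \<cong>\<^sub>a mult"
proof -
  obtain x y where gens: "vec.span ({x, y} \<union> L 1) = UNIV"
    using extend_span5(2)[of "L 1"] d1 by auto
  define c where "c = x \<cdot> y"
  have "L 1 \<noteq> {0}" using d1 dim_L_0[of 1] by auto
  then have "vec.dim (L 2) < 3" using dim_less[of 1] d1 by (simp add: eval_nat_numeral)
  moreover have "3 \<le> Suc (vec.dim (L 2))"
    using vec.dim_subset[OF two_gens_L1[OF gens]] d1 by (simp add: vec.dim_insert split: if_splits)
  ultimately have d2: "vec.dim (L 2) = 2" by linarith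
  then have "L 2 \<noteq> {0}" using dim_L_0[of 2] by auto
  then have d3: "vec.dim (L 3) < 2" using dim_less[of 2] d2 by (simp add: eval_nat_numeral)
  have cL: "c \<in> L 1" unfolding c_def by (rule prod_in_L1)
  have cL2: "v \<cdot> c \<in> L 2" for v using L_mult(1)[OF cL] by (simp add: eval_nat_numeral)
  show ?thesis
  proof (cases "L 3 = {0}")
    case True
    have L2mult: "v \<cdot> u = 0" "u \<cdot> v = 0" if "u \<in> L 2" for u v
      using L_mult[OF that, of v] True by (simp_all add: eval_nat_numeral)
    define d e where "d = x \<cdot> c" and "e = y \<cdot> c"
    have de: "v \<cdot> d = 0" "d \<cdot> v = 0" "v \<cdot> e = 0" "e \<cdot> v = 0" for v
      unfolding d_def e_def by (rule L2mult[OF cL2])+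
    let ?S = "vec.span {x, y, c, d, e}"
    have S: "x \<in> ?S" "y \<in> ?S" "c \<in> ?S" "d \<in> ?S" "e \<in> ?S" by (auto intro: vec.span_base)
    have "L 2 \<subseteq> ?S"
      using S True by (intro two_gens_L2[OF gens]) (auto simp: c_def d_def e_def vec.span_zero)
    then have "L 1 \<subseteq> ?S"
      using S two_gens_L1[OF gens] vec.span_minimal[of "insert (x \<cdot> y) (L 2)" ?S] by (auto simp: c_def)
    then have sp: "UNIV \<subseteq> ?S" using S by (intro UNIV_subset[OF gens]) auto
    have "g54 \<cong>\<^sub>a mult"
      by (rule alg_iso_basis5[OF alg table_in_algebras(7) ac table_ac(7), of x y c d e])
        (use sp in \<open>simp_all add: coord_simps de c_def[symmetric] d_def[symmetric] e_def[symmetric]\<close>)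
    then show ?thesis ..
  next
    case False
    then have d3: "vec.dim (L 3) = 1" using d3 dim_L_0[of 3] by linarith
    then have "vec.dim (L 4) = 0" using dim_less[OF False] by (simp add: eval_nat_numeral)
    then have L4: "L 4 = {0}" by (simp only: dim_L_0)
    \<comment> \<open>\<open>L 2\<close> modulo \<open>L 3\<close> is a line that contains the
      classes of x c and y c. Either x c is zero there and the generators are swapped, or a multiple
      of x is subtracted from y; this changes neither c nor x c.\<close>
    have "\<exists>x y. vec.span ({x, y} \<union> L 1) = UNIV \<and> y \<cdot> (x \<cdot> y) \<in> L 3"
    proof (cases "x \<cdot> c \<in> L 3")
      case True
      have "x \<cdot> (y \<cdot> x) = - (x \<cdot> c)" using ac[of y x] by (simp add: bil c_def)
      then have "x \<cdot> (y \<cdot> x) \<in> L 3" using L_neg[OF True] by simp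
      moreover have "vec.span ({y, x} \<union> L 1) = UNIV" using gens by (simp add: insert_commute)
      ultimately show ?thesis by blast
    next
      case False
      obtain t where t: "y \<cdot> c - t *s (x \<cdot> c) \<in> L 3"
        by (rule subspace_dim_Suc_decomp[of "L 3" "L 2" "x \<cdot> c" "y \<cdot> c"])
          (use False d2 d3 cL2 lcs_Suc_subset[of mult 2] in \<open>auto simp: subspace_lcs eval_nat_numeral\<close>)
      have "(y - t *s x) \<cdot> (x \<cdot> (y - t *s x)) = y \<cdot> c - t *s (x \<cdot> c)" by (simp add: bil c_def)
      then have "(y - t *s x) \<cdot> (x \<cdot> (y - t *s x)) \<in> L 3" using t by simp
      moreover have "vec.span ({x, y - t *s x} \<union> L 1) = UNIV"
      proof -
        let ?S = "vec.span ({x, y - t *s x} \<union> L 1)"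
        have m: "x \<in> ?S" "y - t *s x \<in> ?S" "L 1 \<subseteq> ?S" by (auto intro: vec.span_base)
        then have "(y - t *s x) + t *s x \<in> ?S" by (intro vec.span_add vec.span_scale)
        then have "y \<in> ?S" by simp
        then show ?thesis
          using m UNIV_subset[OF gens vec.subspace_span, of "{x, y - t *s x} \<union> L 1"] by auto
      qed
      ultimately show ?thesis by blast
    qed
    then show ?thesis using classify_class4 L4 by blast
  qed
qed

text \<open>With a single generator x modulo \<open>L 1\<close> the only basic product is x x = 0,
  so \<open>L 1\<close> would lie in \<open>L 2\<close>, against the strict descent of
  dimensions.\<close>

lemma dim_L1_le: "vec.dim (L 1) \<le> 3"
proof (rule ccontr)
  assume "\<not> ?thesis"
  then have d: "4 \<le> vec.dim (L 1)" by simp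
  obtain x where "vec.span (insert x (L 1)) = UNIV" using extend_span5(1)[OF d] by blast
  then have "L 1 \<subseteq> L 2"
    by (intro L1_subset[of x x x]) (auto simp: subspace_lcs vec.subspace_0)
  then have le: "vec.dim (L 1) \<le> vec.dim (L (Suc 1))"
    using vec.dim_subset[of "L 1" "L 2"] by (simp add: eval_nat_numeral)
  have "vec.dim (L 1) \<noteq> 0" using d by linarith
  then have "L 1 \<noteq> {0}" by (simp only: dim_L_0 not_False_eq_True)
  from dim_less[OF this] le show False by linarith
qed

lemma classification:
  "\<exists>\<nu>\<in>{C5, n3_C2, n4_C, g51, g52, g53, g54, g55, g56, M5}. \<nu> \<cong>\<^sub>a mult"
proof -
  consider "vec.dim (L 1) = 0" | "vec.dim (L 1) = 1" | "vec.dim (L 1) = 2" | "vec.dim (L 1) = 3"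
    using dim_L1_le by linarith
  then show ?thesis
  proof cases
    case 1
    then show ?thesis using classify_dim0 by simp
  next
    case 2
    then show ?thesis using classify_dim1 by auto
  next
    case 3
    then show ?thesis using classify_dim2 by auto
  next
    case 4
    then show ?thesis using classify_dim3 by auto
  qed
qed

end

subsection \<open>The degeneration order\<close>

datatype label = Z | N3 | N4 | G1 | G2 | G3 | G4 | G5 | G6 | M

primrec model :: "label \<Rightarrow> 5 alg" where
  "model Z = C5" | "model N3 = n3_C2" | "model N4 = n4_C" | "model G1 = g51" | "model G2 = g52"
| "model G3 = g53" | "model G4 = g54" | "model G5 = g55" | "model G6 = g56" | "model M = M5"

text \<open>The principal down-sets of the expected order, listed in full so that every question
  about the order becomes a finite check.\<close>

primrec down :: "label \<Rightarrow> label set" where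
  "down Z = {Z}"
| "down N3 = {N3, Z}"
| "down G1 = {G1, N3, Z}"
| "down G2 = {G2, N3, Z}"
| "down N4 = {N4, G2, N3, Z}"
| "down G3 = {G3, N4, G1, G2, N3, Z}"
| "down G4 = {G4, N4, G2, N3, Z}"
| "down G5 = {G5, N4, G2, N3, Z}"
| "down G6 = {G6, G5, G4, G3, N4, G1, G2, N3, Z}"
| "down M = {M, G3, N4, G1, G2, N3, Z}"

definition edges :: "(label \<times> label) set" where
  "edges = {(G6, G5), (G6, G4), (G6, G3), (M, G3), (G5, N4), (G4, N4), (G3, N4), (G3, G1),
     (N4, G2), (G2, N3), (G1, N3), (N3, Z)}"

lemma model_in_nilpotent_malcev: "model a \<in> nilpotent_malcev"
  by (cases a) (simp_all add: table_in_nilpotent_malcev)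

lemma nilpotent_malcev_in_algebras: "A \<in> nilpotent_malcev \<Longrightarrow> A \<in> algebras"
  by (simp add: nilpotent_malcev_def malcev_def)

lemma model_in_algebras: "model a \<in> algebras"
  by (intro nilpotent_malcev_in_algebras model_in_nilpotent_malcev)

text \<open>What excludes what: \<open>jacobi\<close> bars \<open>M5\<close> below Lie algebras;
  \<open>sq_dim_le2\<close> bars \<open>g54\<close>, \<open>g55\<close>, \<open>g56\<close> below
  \<open>M5\<close>, \<open>g53\<close>, \<open>n4_C\<close>; \<open>forms_decomposable\<close> bars
  \<open>g51\<close>, \<open>g53\<close>, \<open>g56\<close> below \<open>g54\<close>,
  \<open>g55\<close> and their limits; \<open>class_le2\<close> bars \<open>n4_C\<close> below
  \<open>g51\<close> and \<open>g52\<close>; \<open>sq_dim_le1\<close> bars \<open>g52\<close> below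
  \<open>g51\<close>. Finally \<open>class_le3\<close> forbids \<open>g54\<close> to
  \<open>g55\<close>, and \<open>sq_mult_rank_le1\<close> forbids the reverse.\<close>

lemma degenerates_imp_down:
  assumes "model a \<leadsto> model b" shows "b \<in> down a"
proof -
  note inv = sq_zero_degenerates class_le2_degenerates class_le3_degenerates jacobi_degenerates
    sq_dim_le1_degenerates sq_dim_le2_degenerates forms_decomposable_degenerates
    sq_mult_rank_le1_degenerates
  show ?thesis
    using inv[OF model_in_algebras assms]
    by (cases a; cases b; simp add: sq_zero_table sq_dim_le1_table sq_dim_le2_table class_le2_table
        class_le3_table forms_decomposable_table sq_mult_rank_le1_table jacobi_table)
qed

lemma edges_imp_degenerates: "(a, b) \<in> edges \<Longrightarrow> model a \<leadsto> model b"
  unfolding edges_def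
  by (auto intro: g56_degenerates_g55 g56_degenerates_g54 g56_degenerates_g53 M5_degenerates_g53
      g55_degenerates_n4 g54_degenerates_n4 g53_degenerates_n4 g53_degenerates_g51 n4_degenerates_g52
      g52_degenerates_n3 g51_degenerates_n3 n3_degenerates_C5)

lemma edges_rtrancl_imp_degenerates: "(a, b) \<in> edges\<^sup>* \<Longrightarrow> model a \<leadsto> model b"
proof (induct rule: rtrancl_induct)
  case base
  then show ?case by (intro alg_iso_imp_degenerates model_in_algebras alg_iso_refl)
next
  case (step b c)
  then show ?case by (blast intro: degenerates_trans edges_imp_degenerates model_in_algebras)
qed

lemma down_imp_edges_rtrancl:
  assumes "b \<in> down a" shows "(a, b) \<in> edges\<^sup>*"
proof -
  have e: "(G6, G5) \<in> edges" "(G6, G4) \<in> edges" "(G6, G3) \<in> edges" "(M, G3) \<in> edges"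
    "(G5, N4) \<in> edges" "(G4, N4) \<in> edges" "(G3, N4) \<in> edges" "(G3, G1) \<in> edges"
    "(N4, G2) \<in> edges" "(G2, N3) \<in> edges" "(G1, N3) \<in> edges" "(N3, Z) \<in> edges"
    by (simp_all add: edges_def)
  have N3: "b \<in> down N3 \<Longrightarrow> (N3, b) \<in> edges\<^sup>*" for b using e(12) by auto
  have G1: "b \<in> down G1 \<Longrightarrow> (G1, b) \<in> edges\<^sup>*" for b
    using N3[of b] converse_rtrancl_into_rtrancl[OF e(11)] by auto
  have G2: "b \<in> down G2 \<Longrightarrow> (G2, b) \<in> edges\<^sup>*" for b
    using N3[of b] converse_rtrancl_into_rtrancl[OF e(10)] by auto
  have N4: "b \<in> down N4 \<Longrightarrow> (N4, b) \<in> edges\<^sup>*" for b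
    using G2[of b] converse_rtrancl_into_rtrancl[OF e(9)] by auto
  have G3: "b \<in> down G3 \<Longrightarrow> (G3, b) \<in> edges\<^sup>*" for b
    using N4[of b] G1[of b] converse_rtrancl_into_rtrancl[OF e(7)]
      converse_rtrancl_into_rtrancl[OF e(8)] by auto
  have G4: "b \<in> down G4 \<Longrightarrow> (G4, b) \<in> edges\<^sup>*" for b
    using N4[of b] converse_rtrancl_into_rtrancl[OF e(6)] by auto
  have G5: "b \<in> down G5 \<Longrightarrow> (G5, b) \<in> edges\<^sup>*" for b
    using N4[of b] converse_rtrancl_into_rtrancl[OF e(5)] by auto
  have G6: "b \<in> down G6 \<Longrightarrow> (G6, b) \<in> edges\<^sup>*" for b
    using G3[of b] G4[of b] G5[of b] converse_rtrancl_into_rtrancl[OF e(1)]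
      converse_rtrancl_into_rtrancl[OF e(2)] converse_rtrancl_into_rtrancl[OF e(3)] by auto
  have M: "b \<in> down M \<Longrightarrow> (M, b) \<in> edges\<^sup>*" for b
    using G3[of b] converse_rtrancl_into_rtrancl[OF e(4)] by auto
  show ?thesis
    using assms N3 G1 G2 N4 G3 G4 G5 G6 M by (cases a) auto
qed

text \<open>Closes the circle: degeneration implies membership in \<open>down\<close>, membership
  gives a path of edges, and a path gives a degeneration.\<close>

lemma model_degenerates_iff: "model a \<leadsto> model b \<longleftrightarrow> b \<in> down a"
  using degenerates_imp_down down_imp_edges_rtrancl edges_rtrancl_imp_degenerates by blast

lemma down_iff_edges_rtrancl: "b \<in> down a \<longleftrightarrow> (a, b) \<in> edges\<^sup>*"
  using degenerates_imp_down down_imp_edges_rtrancl edges_rtrancl_imp_degenerates by blast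

lemma ex_label: "(\<exists>c. P c) \<longleftrightarrow>
    P Z \<or> P N3 \<or> P N4 \<or> P G1 \<or> P G2 \<or> P G3 \<or> P G4 \<or> P G5 \<or> P G6 \<or> P M"
  by (metis label.exhaust)

lemma edges_iff_cover:
  "(a, b) \<in> edges \<longleftrightarrow> b \<in> down a \<and> a \<noteq> b \<and> \<not> (\<exists>c. c \<noteq> a \<and> c \<noteq> b \<and> c \<in> down a \<and> b \<in> down c)"
  unfolding ex_label by (cases a; cases b; simp add: edges_def)

text \<open>Isomorphism gives degenerations in both directions, and no two distinct labels lie in
  each other's down-sets.\<close>

lemma model_iso_iff: "model a \<cong>\<^sub>a model b \<longleftrightarrow> a = b"
proof
  assume iso: "model a \<cong>\<^sub>a model b"
  then have "b \<in> down a" "a \<in> down b"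
    by (intro degenerates_imp_down alg_iso_imp_degenerates model_in_algebras iso alg_iso_sym)+
  then show "a = b" by (cases a; cases b; simp)
qed (simp add: alg_iso_refl)

lemma ex_model_iso:
  assumes "malcev A" "\<exists>k. lcs A k = {0}" shows "\<exists>a. model a \<cong>\<^sub>a A"
proof -
  interpret lcs_malcev A using assms by unfold_locales
  show ?thesis unfolding ex_label using classification by simp
qed

lemma nilpotent_malcev_model: "A \<in> nilpotent_malcev \<Longrightarrow> \<exists>a. model a \<cong>\<^sub>a A"
  by (intro ex_model_iso nilpotent_imp_lcs) (simp_all add: nilpotent_malcev_def)

lemma degenerates_model:
  assumes "model a \<leadsto> \<kappa>" shows "\<exists>c. model c \<cong>\<^sub>a \<kappa>"
proof (rule ex_model_iso)
  have "malcev (model a)" using model_in_nilpotent_malcev[of a] by (simp add: nilpotent_malcev_def)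
  then show "malcev \<kappa>" by (rule malcev_degenerates[OF model_in_algebras assms])
  have "class_le4 (model a)" by (cases a) (simp_all add: class_le4_table)
  then have "class_le4 \<kappa>" by (rule class_le4_degenerates[OF model_in_algebras assms])
  then show "\<exists>k. lcs \<kappa> k = {0}"
    by (rule class_le4_imp_lcs[OF degenerates_in_algebras[OF model_in_algebras assms]])
qed

section \<open>From labels to arbitrary algebras\<close>

text \<open>An intermediate algebra is a limit of a model and therefore has a label itself, so the
  quantifier over all algebras becomes one over labels, where primary means covering.\<close>

lemma primary_degeneration_iff_edges:
  assumes A: "A \<in> algebras" "model a \<cong>\<^sub>a A" and B: "B \<in> algebras" "model b \<cong>\<^sub>a B"
  shows "primary_degeneration A B \<longleftrightarrow> (a, b) \<in> edges"
proof -
  have deg: "X \<leadsto> Y \<longleftrightarrow> y \<in> down x"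
    if "X \<in> algebras" "Y \<in> algebras" "model x \<cong>\<^sub>a X" "model y \<cong>\<^sub>a Y" for X Y x y
    using degenerates_alg_iso_cong[OF model_in_algebras model_in_algebras that] model_degenerates_iff by blast
  have iso: "X \<cong>\<^sub>a Y \<longleftrightarrow> x = y" if "model x \<cong>\<^sub>a X" "model y \<cong>\<^sub>a Y" for X Y x y
    using model_iso_iff alg_iso_trans alg_iso_sym that by metis
  have "(\<exists>\<kappa>\<in>algebras. \<not> \<kappa> \<cong>\<^sub>a A \<and> \<not> \<kappa> \<cong>\<^sub>a B \<and> A \<leadsto> \<kappa> \<and> \<kappa> \<leadsto> B) \<longleftrightarrow>
      (\<exists>c. c \<noteq> a \<and> c \<noteq> b \<and> c \<in> down a \<and> b \<in> down c)" (is "?L \<longleftrightarrow> ?R")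
  proof
    assume ?L
    then obtain \<kappa> where \<kappa>: "\<kappa> \<in> algebras" "\<not> \<kappa> \<cong>\<^sub>a A" "\<not> \<kappa> \<cong>\<^sub>a B" "A \<leadsto> \<kappa>" "\<kappa> \<leadsto> B" by blast
    have "model a \<leadsto> \<kappa>"
      using degenerates_trans[OF model_in_algebras alg_iso_imp_degenerates[OF model_in_algebras A] \<kappa>(4)] .
    then obtain c where c: "model c \<cong>\<^sub>a \<kappa>" using degenerates_model by blast
    then show ?R using \<kappa> deg[OF A(1) \<kappa>(1) A(2) c] deg[OF \<kappa>(1) B(1) c B(2)] iso[OF c A(2)] iso[OF c B(2)]
      by blast
  next
    assume ?R
    then obtain c where c: "c \<noteq> a" "c \<noteq> b" "c \<in> down a" "b \<in> down c" by blast
    have r: "model c \<cong>\<^sub>a model c" by (rule alg_iso_refl)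
    show ?L
      using c deg[OF A(1) model_in_algebras A(2) r] deg[OF model_in_algebras B(1) r B(2)]
        iso[OF r A(2)] iso[OF r B(2)] model_in_algebras[of c] by blast
  qed
  then show ?thesis
    unfolding primary_degeneration_def edges_iff_cover
    using deg[OF A(1) B(1) A(2) B(2)] iso[OF A(2) B(2)] by blast
qed

text \<open>Injectivity lets a path in the image be lifted: consecutive image edges share a vertex
  only if the original edges do.\<close>

lemma rtrancl_inj_image:
  assumes "inj f"
  shows "(f a, f b) \<in> ((\<lambda>(a, b). (f a, f b)) ` R)\<^sup>* \<longleftrightarrow> (a, b) \<in> R\<^sup>*"
proof
  have "\<exists>b. y = f b \<and> (a, b) \<in> R\<^sup>*" if "(f a, y) \<in> ((\<lambda>(a, b). (f a, f b)) ` R)\<^sup>*" for y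
    using that
  proof (induct rule: rtrancl_induct)
    case (step y z)
    then show ?case using assms by (auto simp: inj_eq intro: rtrancl_into_rtrancl)
  qed auto
  then show "(a, b) \<in> R\<^sup>*" if "(f a, f b) \<in> ((\<lambda>(a, b). (f a, f b)) ` R)\<^sup>*"
    using that assms by (metis injD)
  show "(f a, f b) \<in> ((\<lambda>(a, b). (f a, f b)) ` R)\<^sup>*" if "(a, b) \<in> R\<^sup>*"
    using that by (induct rule: rtrancl_induct) (auto intro: rtrancl_into_rtrancl)
qed

theorem theorem6:
  "{(iso_class A, iso_class B) | A B :: 5 alg.
      A \<in> nilpotent_malcev \<and> B \<in> nilpotent_malcev \<and> primary_degeneration A B}
     = degeneration_graph \<and>
   (\<forall>A \<in> (nilpotent_malcev :: 5 alg set). \<forall>B \<in> nilpotent_malcev.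
      A \<leadsto> B \<longleftrightarrow> (iso_class A, iso_class B) \<in> degeneration_graph\<^sup>*)"
proof -
  define cls where "cls a = iso_class (model a)" for a
  have inj: "inj cls"
    unfolding cls_def by (rule injI) (simp add: iso_class_eq_iff[OF model_in_algebras model_in_algebras] model_iso_iff)
  have graph: "degeneration_graph = (\<lambda>(a, b). (cls a, cls b)) ` edges"
    unfolding degeneration_graph_def edges_def cls_def by simp
  have cls: "iso_class A = cls a" if "A \<in> algebras" "model a \<cong>\<^sub>a A" for A a
    unfolding cls_def using iso_class_eq_iff[OF model_in_algebras that(1)] that(2) by blast
  have "{(iso_class A, iso_class B) | A B :: 5 alg.
      A \<in> nilpotent_malcev \<and> B \<in> nilpotent_malcev \<and> primary_degeneration A B} = degeneration_graph"
    (is "?P = _")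
  proof (intro subset_antisym subsetI)
    fix p assume "p \<in> ?P"
    then obtain A B where AB: "p = (iso_class A, iso_class B)" "A \<in> nilpotent_malcev"
      "B \<in> nilpotent_malcev" "primary_degeneration A B" by blast
    obtain a b where ab: "model a \<cong>\<^sub>a A" "model b \<cong>\<^sub>a B" using nilpotent_malcev_model AB(2,3) by blast
    have alg: "A \<in> algebras" "B \<in> algebras" using AB(2,3) nilpotent_malcev_in_algebras by blast+
    have "(a, b) \<in> edges"
      using primary_degeneration_iff_edges[OF alg(1) ab(1) alg(2) ab(2)] AB(4) by blast
    then show "p \<in> degeneration_graph"
      unfolding graph AB(1) cls[OF alg(1) ab(1)] cls[OF alg(2) ab(2)] by force
  next
    fix p assume "p \<in> degeneration_graph"
    then obtain a b where p: "p = (cls a, cls b)" and "(a, b) \<in> edges" unfolding graph by auto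
    then have "primary_degeneration (model a) (model b)"
      using primary_degeneration_iff_edges[OF model_in_algebras alg_iso_refl model_in_algebras alg_iso_refl]
      by blast
    then show "p \<in> ?P" unfolding p cls_def using model_in_nilpotent_malcev by blast
  qed
  moreover have "A \<leadsto> B \<longleftrightarrow> (iso_class A, iso_class B) \<in> degeneration_graph\<^sup>*"
    if AB: "A \<in> nilpotent_malcev" "B \<in> nilpotent_malcev" for A B :: "5 alg"
  proof -
    obtain a b where ab: "model a \<cong>\<^sub>a A" "model b \<cong>\<^sub>a B" using nilpotent_malcev_model AB by blast
    have alg: "A \<in> algebras" "B \<in> algebras" using AB nilpotent_malcev_in_algebras by blast+
    have "A \<leadsto> B \<longleftrightarrow> (a, b) \<in> edges\<^sup>*"
      using degenerates_alg_iso_cong[OF model_in_algebras model_in_algebras alg ab]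
        model_degenerates_iff down_iff_edges_rtrancl by blast
    then show ?thesis
      unfolding graph cls[OF alg(1) ab(1)] cls[OF alg(2) ab(2)] rtrancl_inj_image[OF inj] .
  qed
  ultimately show ?thesis by blast
qed

end
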